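(* There exist a sequence $(X_n)_{n=1}^\infty$ of minimal shift spaces and a shift space $X$ (over a common finite alphabet) such that $\bar d^H_{\mathcal M}(\mathcal{M}_\sigma(X_n),\mathcal{M}_\sigma(X))\to 0$ while $\bar d^H(X_n,X)\to 1$ as $n\to\infty$.
   Context: For a finite alphabet $\mathscr{A}$, $\mathscr{A}^\infty$ is the set of sequences $x=(x_i)_{i\ge 0}$ with entries in $\mathscr{A}$, with the product topology; $\sigma(x)_j=x_{j+1}$. A shift space is a nonempty closed set $X\subseteq\mathscr{A}^\infty$ with $\sigma(X)\subseteq X$; it is minimal if every orbit $\{\sigma^n(x):n\ge 0\}$, $x\in X$, is dense in $X$. $\mathcal{M}_\sigma(X)$ is the set of $\sigma$-invariant Borel probability measures concentrated on $X$. $\bar d(x,y)=\limsup_{n\to\infty}\frac1n|\{0\le j<n: x_j\ne y_j\}|$. For $\sigma$-invariant measures $\mu,\nu$ on $\mathscr{A}^\infty$, $\bar d_{\mathcal M}(\mu,\nu)=\inf_\xi\xi(\{(x,y):x_0\ne y_0\})$, the infimum over all $\sigma\times\sigma$-invariant Borel probability measures $\xi$ on $\mathscr{A}^\infty\times\mathscr{A}^\infty$ with marginals $\mu,\nu$. For a bounded pseudometric $\rho$, $\rho^H(A,B)=\max\{\sup_{a\in A}\inf_{b\in B}\rho(a,b),\sup_{b\in B}\inf_{a\in A}\rho(a,b)\}$; $\bar d^H$ and $\bar d^H_{\mathcal M}$ are those induced by $\bar d$ and $\bar d_{\mathcal M}$. *)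

theory Defs
  imports "HOL-Probability.Probability"
begin

text \<open>Sequences over a finite alphabet \<open>A\<close> are functions \<open>nat \<Rightarrow> 'a\<close> with values in \<open>A\<close>. The
  ambient type carries the product topology of the discrete topologies, so that \<open>full_shift A\<close> is a
  closed subset of it whose subspace topology is the product topology of \<open>A\<close>
  (\<open>closedin_full_shift\<close> below).\<close>

definition full_shift :: "'a set \<Rightarrow> (nat \<Rightarrow> 'a) set" where
  "full_shift A = {x. \<forall>i. x i \<in> A}"

definition shift :: "(nat \<Rightarrow> 'a) \<Rightarrow> nat \<Rightarrow> 'a" where
  "shift x = (\<lambda>j. x (Suc j))"

definition shift_space :: "'a::discrete_topology set \<Rightarrow> (nat \<Rightarrow> 'a) set \<Rightarrow> bool" where
  "shift_space A X \<longleftrightarrow> X \<noteq> {} \<and> X \<subseteq> full_shift A \<and> closed X \<and> shift ` X \<subseteq> X"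

definition minimal_shift_space :: "'a::discrete_topology set \<Rightarrow> (nat \<Rightarrow> 'a) set \<Rightarrow> bool" where
  "minimal_shift_space A X \<longleftrightarrow>
     shift_space A X \<and> (\<forall>x\<in>X. X \<subseteq> closure {(shift ^^ n) x |n. True})"

definition invariant_measures :: "('b::topological_space \<Rightarrow> 'b) \<Rightarrow> 'b measure set" where
  "invariant_measures T = {M. prob_space M \<and> sets M = sets borel \<and> distr M borel T = M}"

text \<open>A measure on \<open>full_shift A\<close> is represented by its extension by zero to the ambient type. For
  measures concentrated on \<open>full_shift A\<close>, every joining is concentrated on
  \<open>full_shift A \<times> full_shift A\<close>.\<close>

definition shift_measures :: "(nat \<Rightarrow> 'a::discrete_topology) set \<Rightarrow> (nat \<Rightarrow> 'a) measure set" where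
  "shift_measures X = {M \<in> invariant_measures shift. emeasure M X = 1}"

definition joinings :: "(nat \<Rightarrow> 'a::discrete_topology) measure \<Rightarrow> (nat \<Rightarrow> 'a) measure \<Rightarrow>
    ((nat \<Rightarrow> 'a) \<times> (nat \<Rightarrow> 'a)) measure set" where
  "joinings M N = {J \<in> invariant_measures (map_prod shift shift).
     distr J borel fst = M \<and> distr J borel snd = N}"

text \<open>The distances are \<open>ereal\<close>-valued only because this is a complete lattice; for nonempty sets all
  the values below lie in the unit interval.\<close>

definition dbar :: "(nat \<Rightarrow> 'a) \<Rightarrow> (nat \<Rightarrow> 'a) \<Rightarrow> ereal" where
  "dbar x y = limsup (\<lambda>n. ereal (real (card {j. j < n \<and> x j \<noteq> y j}) / real n))"

definition dbar_measure ::
    "(nat \<Rightarrow> 'a::discrete_topology) measure \<Rightarrow> (nat \<Rightarrow> 'a) measure \<Rightarrow> ereal" where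
  "dbar_measure M N = (INF J\<in>joinings M N. ereal (measure J {(x, y). x 0 \<noteq> y 0}))"

definition hausdorff_pdist :: "('b \<Rightarrow> 'b \<Rightarrow> ereal) \<Rightarrow> 'b set \<Rightarrow> 'b set \<Rightarrow> ereal" where
  "hausdorff_pdist \<rho> A B = max (SUP a\<in>A. INF b\<in>B. \<rho> a b) (SUP b\<in>B. INF a\<in>A. \<rho> a b)"

lemma closedin_full_shift:
  fixes A :: "'a::discrete_topology set"
  shows "closedin (product_topology (\<lambda>_::nat. discrete_topology A) UNIV) X \<longleftrightarrow>
    X \<subseteq> full_shift A \<and> closed X"
proof -
  have fs: "full_shift A = PiE UNIV (\<lambda>_. A)"
    by (auto simp: full_shift_def)
  have disc: "(euclidean :: 'a topology) = discrete_topology UNIV"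
    by (auto simp: topology_eq intro: Topological_Spaces.open_discrete)
  have "product_topology (\<lambda>_::nat. discrete_topology A) UNIV =
      product_topology (\<lambda>_. subtopology euclidean A) UNIV"
    by (simp add: disc)
  also have "\<dots> = subtopology euclidean (full_shift A)"
    by (simp add: fs subtopology_product_topology[symmetric] euclidean_product_topology)
  finally have top: "product_topology (\<lambda>_::nat. discrete_topology A) UNIV =
      subtopology euclidean (full_shift A)" .
  have "full_shift A = (\<Inter>i. (\<lambda>x. x i) -` A)"
    by (auto simp: full_shift_def)
  moreover have "closed ((\<lambda>x::nat \<Rightarrow> 'a. x i) -` A)" for i
    by (intro closed_vimage continuous_on_product_coordinates)
      (simp add: closed_def Topological_Spaces.open_discrete)
  ultimately have "closed (full_shift A)"
    by auto
  thus ?thesis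
    unfolding top by (auto simp: closedin_closed_eq)
qed

end

theory Submission
  imports Defs
begin

text \<open>
  The limit space consists of the two constant sequences \<open>0\<^sup>\<infinity>\<close> and \<open>1\<^sup>\<infinity>\<close>, so that its invariant
  measures are exactly the mixtures of two point masses. The approximating minimal spaces have
  invariant measures close to such mixtures, but contain a point that forever oscillates between the
  two constant sequences.

  Let \<open>m\<^sub>0, m\<^sub>1, \<dots>\<close> be bases at least 3, let \<open>L\<^sub>k = m\<^sub>0 \<cdots> m\<^sub>k\<^sub>-\<^sub>1\<close>, and write \<open>n\<close> in the mixed radix system
  with these bases. The letter \<open>parity n\<close> is the parity of the number of maximal digits, that is of the
  \<open>k\<close> whose digit is \<open>m\<^sub>k - 1\<close>; for bases 2 this would be the Thue--Morse sequence. In terms of blocks,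
  \<open>A\<^sub>0 = 0\<close>, \<open>B\<^sub>k\<close> is the complement of \<open>A\<^sub>k\<close>, and \<open>A\<^sub>k\<^sub>+\<^sub>1 = A\<^sub>k \<dots> A\<^sub>k B\<^sub>k\<close> with \<open>m\<^sub>k\<close> factors. Both \<open>A\<^sub>k\<close> and
  \<open>B\<^sub>k\<close> occur in every block of level \<open>k + 1\<close>, which makes the orbit closure minimal
  (\<open>minimal_subshift\<close>) and closed under complementation. If \<open>\<Sum>\<^sub>k 1 / m\<^sub>k \<le> e\<close>, then at every level at most
  the proportion \<open>e\<close> of \<open>A\<^sub>k\<close> consists of ones (\<open>ones_le\<close>). The theorem follows by letting \<open>e\<close> tend to 0.

  \<^bold>\<open>Every invariant measure is near a mixture.\<close> For most positions the level-\<open>k\<close> block and the next one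
  have the type (\<open>A\<close> or \<open>B\<close>) of the level-\<open>k + 1\<close> block around them; the exceptions have frequency at most
  \<open>3 / m\<^sub>k\<close>. A window of length \<open>L\<^sub>k\<close> over two adjacent blocks of equal type is a rotation of that block,
  and the majority letter in the window reveals the type. So, for any invariant measure, the set where
  the majorities of the initial windows of length \<open>L\<^sub>k\<close> and \<open>L\<^sub>k\<^sub>+\<^sub>1\<close> differ has measure at most
  \<open>3 / m\<^sub>k + 3 / m\<^sub>k\<^sub>+\<^sub>1\<close> (\<open>measure_jump_le\<close>). These bounds sum to \<open>6 e\<close>. By Borel--Cantelli the majorities
  converge almost everywhere to a shift-invariant limit, the mode, which differs from the first letter on a
  set of measure at most \<open>6 e\<close>. Pairing a point with the constant sequence of its mode is the required
  joining.

  \<^bold>\<open>Every mixture is near an invariant measure.\<close> Shift \<open>parity\<close> by a random number whose mixed radix digits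
  are independent and uniform. Almost surely only finitely many digits are maximal, so the shifts converge
  pointwise; the law of the limit is an invariant measure under which the first letter is 1 with probability
  at most \<open>e\<close>. Complementing a point of this law according to an independent point of
  the mixture gives the joining.

  \<^bold>\<open>An oscillating point.\<close> The word \<open>A\<^sub>k B\<^sub>k\<close> is a suffix of \<open>A\<^sub>k\<^sub>+\<^sub>1\<close>, which is a suffix of \<open>B\<^sub>k\<^sub>+\<^sub>2\<close>, and
  the same holds with \<open>A\<close> and \<open>B\<close> exchanged. So every prefix \<open>A\<^sub>0 B\<^sub>2 A\<^sub>4 \<dots>\<close> of the infinite concatenation
  \<open>A\<^sub>0 B\<^sub>2 A\<^sub>4 B\<^sub>6 \<dots>\<close> is a suffix of some block, and the concatenation lies in the orbit
  closure. Its factors grow so fast that each outweighs all the earlier ones, so the point has upper density of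
  disagreement at least \<open>1 - 2 e\<close> with either constant sequence.\<close>

section \<open>Counting residues in windows\<close>

lemma mod_bij_window:
  fixes a p :: nat
  assumes "0 < p"
  shows "bij_betw (\<lambda>j. j mod p) {a..<a + p} {..<p}"
proof -
  have "x = y" if "x \<le> y" "a \<le> x" "y < a + p" "x mod p = y mod p" for x y
  proof -
    have "p dvd y - x" using that by (metis mod_eq_dvd_iff_nat)
    then show "x = y" using that dvd_imp_le[of p "y - x"] by linarith
  qed
  then have inj: "inj_on (\<lambda>j. j mod p) {a..<a + p}"
    by (intro inj_onI) (metis atLeastLessThan_iff nat_le_linear)
  have "(\<lambda>j. j mod p) ` {a..<a + p} \<subseteq> {..<p}" using assms by auto
  then have "(\<lambda>j. j mod p) ` {a..<a + p} = {..<p}"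
    using card_image[OF inj] by (intro card_subset_eq) auto
  then show ?thesis using inj by (simp add: bij_betw_def)
qed

text \<open>This bounds how many positions lie within distance \<open>q\<close> of the end of their period, which are the
  exceptional positions of the block structure below.\<close>

lemma card_mod_near_period_le:
  fixes a p q r :: nat
  assumes "p > 0"
  shows "card {j \<in> {a..<a + r * p}. p \<le> j mod p + q} \<le> r * q"
proof (induction r arbitrary: a)
  case 0
  then show ?case by simp
next
  case (Suc r)
  have one: "card {j \<in> {a..<a + p}. p \<le> j mod p + q} \<le> q"
  proof -
    have inj: "inj_on (\<lambda>j. j mod p) {a..<a + p}"
      using mod_bij_window[OF assms] by (simp add: bij_betw_def)
    have "card {j \<in> {a..<a + p}. p \<le> j mod p + q} =
        card ((\<lambda>j. j mod p) ` {j \<in> {a..<a + p}. p \<le> j mod p + q})"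
      by (rule card_image[symmetric], rule inj_on_subset[OF inj]) auto
    also have "\<dots> \<le> card {p - q..<p}"
      using assms by (intro card_mono) auto
    finally show ?thesis by simp
  qed
  have "{j \<in> {a..<a + Suc r * p}. p \<le> j mod p + q} \<subseteq>
      {j \<in> {a..<a + p}. p \<le> j mod p + q} \<union> {j \<in> {a + p..<(a + p) + r * p}. p \<le> j mod p + q}"
    by auto
  then have "card {j \<in> {a..<a + Suc r * p}. p \<le> j mod p + q} \<le>
      card {j \<in> {a..<a + p}. p \<le> j mod p + q} + card {j \<in> {a + p..<(a + p) + r * p}. p \<le> j mod p + q}"
    by (intro order_trans[OF card_mono card_Un_le]) auto
  then show ?case using one Suc[of "a + p"] by simp
qed

lemma card_mod_window:
  fixes a p :: nat
  assumes "0 < p"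
  shows "card {j \<in> {a..<a + p}. P (j mod p)} = card {r. r < p \<and> P r}"
proof (rule bij_betw_same_card)
  show "bij_betw (\<lambda>j. j mod p) {j \<in> {a..<a + p}. P (j mod p)} {r. r < p \<and> P r}"
  proof (rule bij_betw_subset[OF mod_bij_window[OF assms]])
    show "(\<lambda>j. j mod p) ` {j \<in> {a..<a + p}. P (j mod p)} = {r. r < p \<and> P r}" (is "?f ` ?A = ?B")
    proof
      show "?B \<subseteq> ?f ` ?A"
      proof
        fix r assume r: "r \<in> ?B"
        then have "r \<in> ?f ` {a..<a + p}"
          using mod_bij_window[OF assms, of a] by (auto simp: bij_betw_def)
        then show "r \<in> ?f ` ?A" using r by auto
      qed
    qed (use assms in auto)
  qed auto
qed

lemma card_mod_windows:
  fixes p q :: nat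
  assumes "0 < p"
  shows "card {j. j < q * p \<and> P (j mod p)} = q * card {r. r < p \<and> P r}"
proof (induction q)
  case (Suc q)
  have split: "{j. j < Suc q * p \<and> P (j mod p)} =
      {j. j < q * p \<and> P (j mod p)} \<union> {j \<in> {q * p..<q * p + p}. P (j mod p)}"
    by auto
  have "card {j. j < Suc q * p \<and> P (j mod p)} =
      card {j. j < q * p \<and> P (j mod p)} + card {j \<in> {q * p..<q * p + p}. P (j mod p)}"
    unfolding split by (intro card_Un_disjoint) auto
  also have "\<dots> = q * card {r. r < p \<and> P r} + card {r. r < p \<and> P r}"
    by (simp only: Suc card_mod_window[OF assms])
  finally show ?case by (simp only: mult_Suc add.commute)
qed simp

section \<open>Windows, closures and orbit closures\<close>

lemma shift_funpow: "(shift ^^ n) x = (\<lambda>j. x (n + j))"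
  by (induction n arbitrary: x) (simp_all add: shift_def funpow_swap1)

text \<open>The closure of the orbit in terms of finite windows (\<open>orbit_closure_eq\<close>), which is how membership
  is used throughout.\<close>

definition orbit_closure :: "(nat \<Rightarrow> 'a) \<Rightarrow> (nat \<Rightarrow> 'a) set" where
  "orbit_closure z = {x. \<forall>N. \<exists>a. \<forall>j<N. x j = z (a + j)}"

text \<open>A set that depends on finitely many coordinates contains a cylinder around each of its points. Besides
  its topological use, this settles the Borel measurability of all events about finite windows.\<close>

lemma open_finite_window:
  fixes E :: "(nat \<Rightarrow> 'a::discrete_topology) set"
  assumes "\<And>x y. x \<in> E \<Longrightarrow> (\<And>j. j < N \<Longrightarrow> y j = x j) \<Longrightarrow> y \<in> E"
  shows "open E"
  unfolding open_subopen[of E]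
proof
  fix x assume x: "x \<in> E"
  have "open {y. \<forall>i\<in>{..<N}. y i \<in> {x i}}"
    by (rule product_topology_basis'[where x = "\<lambda>i. i" and U = "\<lambda>i. {x i}"])
      (auto intro: Topological_Spaces.open_discrete)
  moreover have "{y. \<forall>i\<in>{..<N}. y i \<in> {x i}} \<subseteq> E"
    using assms[OF x] by auto
  ultimately show "\<exists>T. open T \<and> x \<in> T \<and> T \<subseteq> E"
    by (intro exI[of _ "{y. \<forall>i\<in>{..<N}. y i \<in> {x i}}"]) auto
qed

lemma closure_iff_windows:
  fixes U :: "(nat \<Rightarrow> 'a::discrete_topology) set"
  shows "x \<in> closure U \<longleftrightarrow> (\<forall>N. \<exists>u\<in>U. \<forall>j<N. u j = x j)"
proof
  assume x: "x \<in> closure U"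
  show "\<forall>N. \<exists>u\<in>U. \<forall>j<N. u j = x j"
  proof
    fix N
    have "open {u. \<forall>j<N. u j = x j}" by (rule open_finite_window[of _ N]) auto
    then have "U \<inter> {u. \<forall>j<N. u j = x j} \<noteq> {}"
      using x unfolding closure_iff_nhds_not_empty by blast
    then show "\<exists>u\<in>U. \<forall>j<N. u j = x j" by auto
  qed
next
  assume r: "\<forall>N. \<exists>u\<in>U. \<forall>j<N. u j = x j"
  have "U \<inter> V \<noteq> {}" if V: "open V" "x \<in> V" for V
  proof -
    obtain W where W: "x \<in> (\<Pi>\<^sub>E i\<in>UNIV. W i)" "finite {i. W i \<noteq> UNIV}" "(\<Pi>\<^sub>E i\<in>UNIV. W i) \<subseteq> V"
      using product_topology_open_contains_basis[OF V(1)[unfolded open_fun_def] V(2)] by auto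
    obtain N where N: "\<And>i. W i \<noteq> UNIV \<Longrightarrow> i < N"
      using W(2) finite_nat_set_iff_bounded by auto
    obtain u where u: "u \<in> U" "\<And>j. j < N \<Longrightarrow> u j = x j" using r by blast
    have "u i \<in> W i" for i using W(1) N[of i] u(2)[of i] by (cases "W i = UNIV") auto
    then show ?thesis using u(1) W(3) by auto
  qed
  then show "x \<in> closure U" unfolding closure_iff_nhds_not_empty by blast
qed

lemma orbit_closure_eq:
  fixes z :: "nat \<Rightarrow> 'a::discrete_topology"
  shows "orbit_closure z = closure {(shift ^^ n) z |n. True}"
proof -
  have "(\<exists>u\<in>{(shift ^^ n) z |n. True}. \<forall>j<N. u j = x j) \<longleftrightarrow> (\<exists>n. \<forall>j<N. (shift ^^ n) z j = x j)"
    for x N by blast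
  then show ?thesis
    unfolding set_eq_iff closure_iff_windows by (simp add: orbit_closure_def shift_funpow eq_commute)
qed

lemma shift_space_orbit_closure:
  fixes z :: "nat \<Rightarrow> 'a::discrete_topology"
  assumes "\<And>n. z n \<in> A"
  shows "shift_space A (orbit_closure z)"
  unfolding shift_space_def
proof (intro conjI)
  show "orbit_closure z \<noteq> {}" 
  proof -
    have "z \<in> orbit_closure z" unfolding orbit_closure_def by (auto intro: exI[of _ 0])
    then show ?thesis by blast
  qed
  show "orbit_closure z \<subseteq> full_shift A"
  proof (clarsimp simp: full_shift_def)
    fix x i assume "x \<in> orbit_closure z"
    then obtain a where "\<forall>j<Suc i. x j = z (a + j)" by (auto simp: orbit_closure_def)
    then show "x i \<in> A" using assms by simp
  qed
  show "closed (orbit_closure z)" by (simp add: orbit_closure_eq)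
  show "shift ` orbit_closure z \<subseteq> orbit_closure z"
  proof clarify
    fix x assume x: "x \<in> orbit_closure z"
    show "shift x \<in> orbit_closure z"
      unfolding orbit_closure_def
    proof clarify
      fix N
      obtain a where "\<forall>j<Suc N. x j = z (a + j)" using x by (auto simp: orbit_closure_def)
      then show "\<exists>a. \<forall>j<N. shift x j = z (a + j)"
        by (intro exI[of _ "Suc a"]) (auto simp: shift_def)
    qed
  qed
qed

definition const_seq :: "bool \<Rightarrow> nat \<Rightarrow> nat" where "const_seq b = (\<lambda>_. of_bool b)"

definition two_points :: "(nat \<Rightarrow> nat) set" where "two_points = {const_seq False, const_seq True}"

lemma shift_const_seq [simp]: "shift (const_seq b) = const_seq b"
  by (simp add: const_seq_def shift_def)

lemma const_seq_in [simp]: "const_seq b \<in> two_points"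
  by (cases b) (simp_all add: two_points_def)

lemma shift_space_two_points: "shift_space {0, 1} two_points"
  unfolding shift_space_def
proof (intro conjI)
  have "x \<in> two_points" if x: "x \<in> closure two_points" for x
  proof -
    have "x j = of_bool (x 0 = 1)" for j
    proof -
      obtain u where u: "u \<in> two_points" "\<forall>i<Suc j. u i = x i"
        using x closure_iff_windows by blast
      then have "u 0 = x 0" "u j = x j" by auto
      then show ?thesis using u(1) by (auto simp: two_points_def const_seq_def)
    qed
    then have "x = const_seq (x 0 = 1)" unfolding const_seq_def by (rule ext)
    then show ?thesis by (metis const_seq_in)
  qed
  then have "closure two_points \<subseteq> two_points" by blast
  then show "closed two_points" by (simp add: closure_subset_eq)
  show "shift ` two_points \<subseteq> two_points" by (auto simp: two_points_def)
qed (auto simp: two_points_def full_shift_def const_seq_def)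

section \<open>Invariant measures and visit frequencies\<close>

lemma shift_measures_iff:
  "M \<in> shift_measures Y \<longleftrightarrow>
    prob_space M \<and> sets M = sets borel \<and> distr M borel shift = M \<and> emeasure M Y = 1"
  by (auto simp: shift_measures_def invariant_measures_def)

lemma measurable_shift [measurable]:
  "(shift :: (nat \<Rightarrow> 'a::topological_space) \<Rightarrow> _) \<in> borel_measurable borel"
  unfolding shift_def
  by (intro borel_measurable_continuous_onI continuous_on_coordinatewise_then_product) simp

lemma measurable_shift_funpow [measurable]:
  "(shift ^^ n :: (nat \<Rightarrow> 'a::topological_space) \<Rightarrow> _) \<in> borel_measurable borel"
  unfolding shift_funpow
  by (intro borel_measurable_continuous_onI continuous_on_coordinatewise_then_product) simp

lemma emeasure_shift_funpow_vimage:
  fixes M :: "(nat \<Rightarrow> 'a::topological_space) measure"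
  assumes sets: "sets M = sets borel" and inv: "distr M borel shift = M" and E: "E \<in> sets borel"
  shows "emeasure M ((shift ^^ n) -` E) = emeasure M E"
proof (induction n)
  case (Suc n)
  have sp: "space M = UNIV" using sets_eq_imp_space_eq[OF sets] by simp
  have sm: "shift \<in> measurable M borel"
    using measurable_shift by (simp add: measurable_cong_sets[OF sets refl])
  have nE: "(shift ^^ n) -` E \<in> sets borel"
    using measurable_sets[OF measurable_shift_funpow E, of n] by simp
  have "emeasure M ((shift ^^ n) -` E) = emeasure (distr M borel shift) ((shift ^^ n) -` E)"
    using inv by simp
  also have "\<dots> = emeasure M (shift -` ((shift ^^ n) -` E))"
    using emeasure_distr[OF sm nE] sp by simp
  also have "shift -` ((shift ^^ n) -` E) = (shift ^^ Suc n) -` E"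
    by (simp add: funpow_Suc_right vimage_comp del: funpow.simps)
  finally show ?case using Suc by (simp only:)
qed simp

text \<open>If every orbit in \<open>Y\<close> spends at most \<open>c\<close> of its first \<open>P\<close> steps in \<open>E\<close>, then integrating the
  number of visits and using invariance bounds the measure of \<open>E\<close> by \<open>c / P\<close>. This transfers counting
  in the generating sequence to all invariant measures.\<close>

lemma measure_le_visit_frequency:
  fixes M :: "(nat \<Rightarrow> 'a::discrete_topology) measure"
  assumes M: "M \<in> shift_measures Y" and Y: "closed Y" and E: "E \<in> sets borel"
    and visits: "\<And>x. x \<in> Y \<Longrightarrow> card {j. j < P \<and> (shift ^^ j) x \<in> E} \<le> c"
  shows "real P * measure M E \<le> real c"
proof -
  interpret prob_space M using M by (simp add: shift_measures_iff)
  have sets: "sets M = sets borel" and inv: "distr M borel shift = M" and MY: "emeasure M Y = 1"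
    using M by (auto simp: shift_measures_iff)
  have sp: "space M = UNIV" using sets_eq_imp_space_eq[OF sets] by simp
  have nE: "(shift ^^ j) -` E \<in> sets M" for j
    using measurable_sets[OF measurable_shift_funpow E, of j] sets by simp
  have "AE x in M. x \<in> Y"
    using MY Y sets by (intro AE_I_eq_1) (auto simp: sp)
  moreover have "(\<Sum>j<P. indicator ((shift ^^ j) -` E) x) \<le> (of_nat c :: ennreal)" if "x \<in> Y" for x
  proof -
    have "(\<Sum>j<P. indicator ((shift ^^ j) -` E) x) =
        (of_nat (card {j. j < P \<and> (shift ^^ j) x \<in> E}) :: ennreal)"
      by (simp add: indicator_def sum.If_cases Collect_conj_eq lessThan_def)
    then show ?thesis using visits[OF that] by simp
  qed
  ultimately have "(\<integral>\<^sup>+x. (\<Sum>j<P. indicator ((shift ^^ j) -` E) x) \<partial>M) \<le> (\<integral>\<^sup>+x. of_nat c \<partial>M)"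
    by (intro nn_integral_mono_AE) auto
  also have "\<dots> = of_nat c" by (simp add: emeasure_space_1)
  finally have "(\<Sum>j<P. emeasure M ((shift ^^ j) -` E)) \<le> of_nat c"
    using nE by (subst (asm) nn_integral_sum) auto
  then have "of_nat P * emeasure M E \<le> of_nat c"
    by (simp add: emeasure_shift_funpow_vimage[OF sets inv E])
  then have "ennreal (real P * measure M E) \<le> ennreal (real c)"
    by (simp add: emeasure_eq_measure ennreal_mult ennreal_of_nat_eq_real_of_nat)
  then show ?thesis by (simp add: ennreal_le_iff)
qed

lemma measurable_map_prod_shift [measurable]:
  "map_prod shift shift \<in> borel_measurable (borel :: ((nat \<Rightarrow> nat) \<times> (nat \<Rightarrow> nat)) measure)"
  unfolding borel_prod[symmetric] map_prod_def by measurable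

lemma sets_first_letters_differ [measurable]:
  "{(x, y). x 0 \<noteq> y 0} \<in> sets (borel :: ((nat \<Rightarrow> nat) \<times> (nat \<Rightarrow> nat)) measure)"
proof -
  have "open ((\<lambda>p. (fst p 0, snd p 0)) -` {(i, j). i \<noteq> j} :: ((nat \<Rightarrow> nat) \<times> (nat \<Rightarrow> nat)) set)"
  proof (rule open_vimage)
    show "open {(i, j). i \<noteq> (j :: nat)}"
      using open_diagonal_complement[where 'a = nat] by (simp add: case_prod_unfold)
    have "continuous_on UNIV (\<lambda>p :: (nat \<Rightarrow> nat) \<times> (nat \<Rightarrow> nat). fst p 0)"
      and "continuous_on UNIV (\<lambda>p :: (nat \<Rightarrow> nat) \<times> (nat \<Rightarrow> nat). snd p 0)"
      by (rule continuous_on_product_then_coordinatewise; simp add: continuous_on_fst continuous_on_snd)+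
    then show "continuous_on UNIV (\<lambda>p :: (nat \<Rightarrow> nat) \<times> (nat \<Rightarrow> nat). (fst p 0, snd p 0))"
      by (intro continuous_on_Pair)
  qed
  then have "open ({(x, y). x 0 \<noteq> y 0} :: ((nat \<Rightarrow> nat) \<times> (nat \<Rightarrow> nat)) set)"
    by (simp add: vimage_def case_prod_unfold)
  then show ?thesis by simp
qed

text \<open>For a constant \<open>y\<close> this keeps or complements \<open>x\<close> as a whole; acting coordinatewise, it
  commutes with the shift even where \<open>y\<close> is not constant.\<close>

definition twist :: "(nat \<Rightarrow> nat) \<Rightarrow> (nat \<Rightarrow> nat) \<Rightarrow> nat \<Rightarrow> nat" where
  "twist y x = (\<lambda>j. if y j = 0 then x j else 1 - x j)"

lemma measurable_twist: "(\<lambda>(y, x). (twist y x, y)) \<in> borel_measurable (borel \<Otimes>\<^sub>M borel)"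
proof -
  have "(\<lambda>p. twist (fst p) (snd p)) \<in> borel_measurable (borel \<Otimes>\<^sub>M borel)"
  proof (rule measurable_coordinatewise_then_product)
    fix j
    have "(\<lambda>p. (fst p :: nat \<Rightarrow> nat) j) \<in> borel_measurable (borel \<Otimes>\<^sub>M (borel :: (nat \<Rightarrow> nat) measure))"
      by (rule measurable_compose[OF measurable_fst measurable_product_coordinates])
    then have c: "(\<lambda>p. (fst p :: nat \<Rightarrow> nat) j) \<in> borel \<Otimes>\<^sub>M (borel :: (nat \<Rightarrow> nat) measure) \<rightarrow>\<^sub>M count_space UNIV"
      unfolding measurable_cong_sets[OF refl sets_borel_eq_count_space] .
    have "(\<lambda>p. (snd p :: nat \<Rightarrow> nat) j) \<in> borel_measurable ((borel :: (nat \<Rightarrow> nat) measure) \<Otimes>\<^sub>M borel)"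
      by (rule measurable_compose[OF measurable_snd measurable_product_coordinates])
    then have d: "(\<lambda>p. (snd p :: nat \<Rightarrow> nat) j) \<in> (borel :: (nat \<Rightarrow> nat) measure) \<Otimes>\<^sub>M borel \<rightarrow>\<^sub>M count_space UNIV"
      unfolding measurable_cong_sets[OF refl sets_borel_eq_count_space] .
    note [measurable] = c d
    have [measurable]: "(\<lambda>p. 1 - (snd p :: nat \<Rightarrow> nat) j) \<in> (borel :: (nat \<Rightarrow> nat) measure) \<Otimes>\<^sub>M borel \<rightarrow>\<^sub>M count_space UNIV"
      by (rule measurable_compose[OF d, of "\<lambda>n. 1 - n"]) simp
    have "(\<lambda>p. twist (fst p) (snd p) j) \<in> borel \<Otimes>\<^sub>M borel \<rightarrow>\<^sub>M count_space UNIV"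
      unfolding twist_def by measurable
    then show "(\<lambda>p. twist (fst p) (snd p) j) \<in> borel_measurable (borel \<Otimes>\<^sub>M borel)"
      by (simp add: measurable_cong_sets[OF refl sets_borel_eq_count_space])
  qed
  then show ?thesis
    unfolding borel_prod[symmetric] case_prod_unfold by measurable
qed

lemma shift_twist: "shift (twist y x) = twist (shift y) (shift x)"
  by (simp add: twist_def shift_def)

section \<open>Mixed radix expansions and the parity sequence\<close>

text \<open>The bases have to grow so fast that their reciprocals have a small sum \<open>e\<close>: then a maximal digit is
  exceptional at every level, and also in total over all levels. With \<open>e < 1 / 2\<close> each block has a strict
  majority letter.\<close>

locale radix =
  fixes m :: "nat \<Rightarrow> nat" and e :: real
  assumes m_ge: "\<And>k. 3 \<le> m k"
    and sum_le: "\<And>k. (\<Sum>i<k. 1 / real (m i)) \<le> e"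
    and e_less: "e < 1 / 2"
begin

definition L :: "nat \<Rightarrow> nat" where "L k = (\<Prod>i<k. m i)"

lemma L_Suc: "L (Suc k) = m k * L k"
  by (simp add: L_def)

lemma L_0 [simp]: "L 0 = 1"
  by (simp add: L_def)

lemma L_pos [simp]: "0 < L k"
  unfolding L_def
proof (rule prod_pos)
  show "0 < m i" for i using m_ge[of i] by simp
qed

lemma L_Suc_ge: "3 * L k \<le> L (Suc k)"
  using m_ge[of k] by (simp add: L_Suc)

lemma L_gt: "k < L k"
proof (induction k)
  case (Suc k)
  then show ?case using L_Suc_ge[of k] by linarith
qed simp

lemma L_dvd: "i \<le> k \<Longrightarrow> L i dvd L k"
  by (auto simp: L_def intro!: prod_dvd_prod_subset)

lemma inverse_m_le: "1 / real (m k) \<le> e"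
proof -
  have "1 / real (m k) \<le> (\<Sum>i<Suc k. 1 / real (m i))"
    by (simp add: sum_nonneg)
  then show ?thesis using sum_le[of "Suc k"] by linarith
qed

lemma e_pos: "0 < e"
  using inverse_m_le[of 0] m_ge[of 0] by (smt (verit) divide_pos_pos of_nat_0_less_iff not_numeral_le_zero gr0I)

definition top_digit :: "nat \<Rightarrow> nat \<Rightarrow> bool" where
  "top_digit k n \<longleftrightarrow> (n div L k) mod m k = m k - 1"

primrec low_parity :: "nat \<Rightarrow> nat \<Rightarrow> bool" where
  "low_parity 0 n = False"
| "low_parity (Suc k) n = (low_parity k n \<noteq> top_digit k n)"

text \<open>A generalized Thue--Morse sequence. The count of maximal digits can be cut off at \<open>n\<close>, since \<open>n < L n\<close> makes
  all later digits zero.\<close>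

definition parity :: "nat \<Rightarrow> bool" where "parity n = low_parity n n"

text \<open>The parity of the number of maximal digits from the \<open>k\<close>th on. It depends only on \<open>n div L k\<close>
  (\<open>high_parity_cong\<close>) and tells whether the level-\<open>k\<close> block containing position \<open>n\<close> is complemented.\<close>

definition high_parity :: "nat \<Rightarrow> nat \<Rightarrow> bool" where "high_parity k n = (parity n \<noteq> low_parity k n)"

lemma mod_L_Suc: "n mod L (Suc k) = L k * ((n div L k) mod m k) + n mod L k"
  unfolding L_Suc by (metis mod_mult2_eq mult.commute)

text \<open>In terms of residues, a maximal digit means lying in the last level-\<open>k\<close> block of a level-\<open>k + 1\<close> block.
  This form is convenient for counting in windows.\<close>

lemma top_digit_iff: "top_digit k n \<longleftrightarrow> L (Suc k) \<le> n mod L (Suc k) + L k"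
proof -
  define d where "d = (n div L k) mod m k"
  have d: "d < m k" using m_ge[of k] by (simp add: d_def)
  have r: "n mod L k < L k" by simp
  have "L (Suc k) \<le> n mod L (Suc k) + L k \<longleftrightarrow> m k * L k \<le> Suc d * L k + n mod L k"
    unfolding mod_L_Suc d_def[symmetric] by (simp add: L_Suc algebra_simps)
  also have "\<dots> \<longleftrightarrow> d = m k - 1"
  proof
    assume a: "m k * L k \<le> Suc d * L k + n mod L k"
    also have "\<dots> < Suc (Suc d) * L k" using r by simp
    finally have "m k * L k < Suc (Suc d) * L k" .
    then have "m k < Suc (Suc d)" by (metis mult_less_cancel2)
    then show "d = m k - 1" using d by simp
  next
    assume "d = m k - 1"
    then have "Suc d = m k" using d by simp
    then show "m k * L k \<le> Suc d * L k + n mod L k" by simp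
  qed
  finally show ?thesis by (simp add: top_digit_def d_def)
qed

lemma top_digit_less: "n < L k \<Longrightarrow> \<not> top_digit k n"
  using m_ge[of k] by (simp add: top_digit_def)

lemma low_parity_stable: "n < L k \<Longrightarrow> k \<le> l \<Longrightarrow> low_parity l n = low_parity k n"
proof (induction l)
  case (Suc l)
  show ?case
  proof (cases "k = Suc l")
    case False
    then have kl: "k \<le> l" using Suc by simp
    then have "n < L l" using Suc.prems(1) dvd_imp_le[OF L_dvd[OF kl]] by simp
    then show ?thesis using Suc kl top_digit_less by simp
  qed simp
qed simp

lemma parity_eq_low_parity: "n < L k \<Longrightarrow> parity n = low_parity k n"
  unfolding parity_def using low_parity_stable[of n n k] low_parity_stable[of n k n] L_gt[of n]
  by (metis nat_le_linear)

lemma high_parity_eq_False: "n < L k \<Longrightarrow> \<not> high_parity k n"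
  by (simp add: high_parity_def parity_eq_low_parity)

lemma high_parity_Suc: "high_parity k n = (high_parity (Suc k) n \<noteq> top_digit k n)"
  by (auto simp: high_parity_def)

lemma div_L_mono:
  assumes "n div L k = n' div L k" "k \<le> i" shows "n div L i = n' div L i"
proof -
  obtain c where "L i = L k * c" using L_dvd[OF assms(2)] by (auto simp: dvd_def)
  then show ?thesis using assms(1) by (simp add: div_mult2_eq)
qed

text \<open>Both sides vanish at a level above \<open>n\<close> and \<open>n'\<close>, and the digits from the \<open>k\<close>th on agree; so the claim
  descends from that level to \<open>k\<close>.\<close>

lemma high_parity_cong:
  assumes "n div L k = n' div L k" shows "high_parity k n = high_parity k n'"
proof -
  define K where "K = k + n + n'"
  have "L k \<le> L K" "k \<le> K" using dvd_imp_le[OF L_dvd[of k K]] by (auto simp: K_def)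
  have "high_parity k n = high_parity k n'" if "k \<le> K" "n div L k = n' div L k" "n < L K" "n' < L K" for k
    using that
  proof (induction k rule: inc_induct)
    case base
    then show ?case using high_parity_eq_False by blast
  next
    case (step k)
    then have "n div L (Suc k) = n' div L (Suc k)" using div_L_mono[of n k n' "Suc k"] by simp
    then show ?case using step high_parity_Suc[of k n] high_parity_Suc[of k n'] by (simp add: top_digit_def)
  qed
  then show ?thesis using assms \<open>k \<le> K\<close> L_gt[of K] by (simp add: K_def)
qed

lemma low_parity_mod: "low_parity k n = parity (n mod L k)"
proof -
  have "low_parity k n = low_parity k n'" if "n mod L k = n' mod L k" for n n'
    using that
  proof (induction k)
    case (Suc k)
    then have "n mod L k = n' mod L k"
      by (metis L_dvd le_SucI le_refl mod_mod_cancel)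
    then show ?case using Suc by (simp add: top_digit_iff)
  qed simp
  from this[of n "n mod L k"] show ?thesis by (simp add: parity_eq_low_parity[of "n mod L k" k])
qed

text \<open>The block structure: the level-\<open>k\<close> block containing \<open>n\<close> is a copy of the initial block, complemented
  if and only if \<open>high_parity k n\<close> holds.\<close>

lemma parity_block: "parity n = (parity (n mod L k) \<noteq> high_parity k n)"
  by (auto simp: high_parity_def low_parity_mod)

lemma high_parity_block:
  assumes "n mod L (Suc k) + L k < L (Suc k)"
  shows "high_parity k n = high_parity (Suc k) n"
  using assms high_parity_Suc[of k n] by (simp add: top_digit_iff)

text \<open>Away from the last level-\<open>k\<close> block of a level-\<open>k + 1\<close> block, all level-\<open>k\<close> blocks have the type of
  the surrounding block.\<close>

lemma high_parity_next:
  assumes "n mod L (Suc k) + i + L k < L (Suc k)"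
  shows "high_parity k (n + i) = high_parity (Suc k) n"
proof -
  have lt: "n mod L (Suc k) + i < L (Suc k)" using assms by simp
  then have "(n + i) mod L (Suc k) = n mod L (Suc k) + i"
    by (metis mod_add_left_eq mod_less)
  moreover have "(n + i) div L (Suc k) = n div L (Suc k)"
  proof -
    have "n + i = n div L (Suc k) * L (Suc k) + (n mod L (Suc k) + i)"
      by (metis add.assoc div_mult_mod_eq)
    then show ?thesis using lt by (metis L_pos div_less div_mult_self3 add_0_right less_not_refl)
  qed
  then have "high_parity (Suc k) (n + i) = high_parity (Suc k) n" by (rule high_parity_cong)
  ultimately show ?thesis using assms high_parity_block[of "n + i" k] by simp
qed

definition ones :: "nat \<Rightarrow> nat" where "ones k = card {r. r < L k \<and> parity r}"

text \<open>Of the \<open>m k\<close> blocks that form the initial block of level \<open>k + 1\<close> only the last one is complemented,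
  and it contributes at most \<open>L k\<close> ones.\<close>

lemma ones_Suc: "ones (Suc k) \<le> m k * ones k + L k"
proof -
  have "{r. r < L (Suc k) \<and> parity r} \<subseteq>
      {r. r < m k * L k \<and> parity (r mod L k)} \<union> {L (Suc k) - L k..<L (Suc k)}"
  proof
    fix r assume r: "r \<in> {r. r < L (Suc k) \<and> parity r}"
    then have "high_parity k r = top_digit k r"
      using high_parity_Suc[of k r] high_parity_eq_False[of r "Suc k"] by simp
    then show "r \<in> {r. r < m k * L k \<and> parity (r mod L k)} \<union> {L (Suc k) - L k..<L (Suc k)}"
      using r parity_block[of r k] by (auto simp: top_digit_iff L_Suc[symmetric])
  qed
  then have "ones (Suc k) \<le>
      card {r. r < m k * L k \<and> parity (r mod L k)} + card {L (Suc k) - L k..<L (Suc k)}"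
    unfolding ones_def by (intro order_trans[OF card_mono card_Un_le]) auto
  then show ?thesis using card_mod_windows[OF L_pos, of "m k" k parity] by (simp add: ones_def)
qed

lemma ones_le_sum: "real (ones k) \<le> (\<Sum>i<k. 1 / real (m i)) * real (L k)"
proof (induction k)
  case 0
  have "{r. r < L 0 \<and> parity r} = {}" by (auto simp: parity_def)
  then show ?case by (simp add: ones_def)
next
  case (Suc k)
  have mpos: "0 < real (m k)" using m_ge[of k] by simp
  have "real (ones (Suc k)) \<le> real (m k) * real (ones k) + real (L k)"
    using ones_Suc[of k] by (metis of_nat_add of_nat_le_iff of_nat_mult)
  also have "\<dots> \<le> real (m k) * ((\<Sum>i<k. 1 / real (m i)) * real (L k)) + real (L k)"
    using Suc by (intro add_right_mono mult_left_mono) auto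
  also have "\<dots> = (\<Sum>i<Suc k. 1 / real (m i)) * real (L (Suc k))"
    using mpos by (simp add: L_Suc field_simps)
  finally show ?case .
qed

lemma ones_le: "real (ones k) \<le> e * real (L k)"
  using ones_le_sum[of k] sum_le[of k]
  by (meson mult_right_mono of_nat_0_le_iff order_trans)

lemma ones_less: "2 * ones k < L k"
proof -
  have "real (ones k) < 1 / 2 * real (L k)"
    using ones_le[of k] e_less by (smt (verit) L_pos mult_less_cancel_right of_nat_0_less_iff)
  then show ?thesis by linarith
qed

lemma card_zeros: "card {r. r < L k \<and> \<not> parity r} = L k - ones k"
proof -
  have "{r. r < L k \<and> \<not> parity r} = {..<L k} - {r. r < L k \<and> parity r}" by auto
  then show ?thesis unfolding ones_def by (simp add: card_Diff_subset subset_iff)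
qed

text \<open>If the window meets two adjacent level-\<open>k\<close> blocks of the same type, it contains each residue modulo \<open>L k\<close>
  once and so has the letter counts of such a block.\<close>

lemma ones_window:
  assumes "high_parity k a = high_parity k (a + L k)"
  shows "card {j \<in> {a..<a + L k}. parity j} = (if high_parity k a then L k - ones k else ones k)"
proof -
  have high_parity: "high_parity k j = high_parity k a" if "j \<in> {a..<a + L k}" for j
  proof -
    have "a div L k \<le> j div L k" and "j div L k \<le> (a + L k) div L k"
      using that by (intro div_le_mono; simp)+
    then have "j div L k = a div L k \<or> j div L k = (a + L k) div L k"
      by (auto simp: div_add_self2)
    then show ?thesis using high_parity_cong[of j k a] high_parity_cong[of j k "a + L k"] assms by auto
  qed
  have "{j \<in> {a..<a + L k}. parity j} = {j \<in> {a..<a + L k}. parity (j mod L k) \<noteq> high_parity k a}"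
  proof (intro Collect_cong conj_cong refl)
    fix j assume "j \<in> {a..<a + L k}"
    then show "parity j = (parity (j mod L k) \<noteq> high_parity k a)" using parity_block[of j k] high_parity by metis
  qed
  then have c: "card {j \<in> {a..<a + L k}. parity j} = card {r. r < L k \<and> (parity r \<noteq> high_parity k a)}"
    using card_mod_window[of "L k" a "\<lambda>r. parity r \<noteq> high_parity k a"] by simp
  show ?thesis using c card_zeros[of k] by (simp add: ones_def)
qed

definition parity_seq :: "nat \<Rightarrow> nat" where "parity_seq n = of_bool (parity n)"

definition subshift :: "(nat \<Rightarrow> nat) set" where "subshift = orbit_closure parity_seq"

section \<open>Minimality of the orbit closure\<close>

lemma parity_seq_01: "parity_seq n \<in> {0, 1}" by (simp add: parity_seq_def)

lemma shift_space_subshift: "shift_space {0, 1} subshift"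
  unfolding subshift_def by (rule shift_space_orbit_closure) (rule parity_seq_01)

lemma closed_subshift: "closed subshift" using shift_space_subshift by (simp add: shift_space_def)

lemma subshift_iff: "x \<in> subshift \<longleftrightarrow> (\<forall>N. \<exists>a. \<forall>j<N. x j = parity_seq (a + j))"
  by (simp add: subshift_def orbit_closure_def)

text \<open>The complement of every prefix occurs in the sequence, in the last block of the next level.\<close>

lemma parity_seq_top_block: "parity_seq (L (Suc k) - L k + i) = 1 - parity_seq i" if "i < L k"
proof -
  define n where "n = L (Suc k) - L k + i"
  have le: "L k \<le> L (Suc k)" using L_Suc_ge[of k] by simp
  have n: "n < L (Suc k)" using that le by (simp add: n_def)
  have "n = (m k - 1) * L k + i" by (simp add: n_def L_Suc diff_mult_distrib)
  then have nm: "n mod L k = i" using that by simp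
  have "high_parity k n" using high_parity_Suc[of k n] high_parity_eq_False[OF n] n le by (simp add: top_digit_iff n_def)
  then show ?thesis using parity_block[of n k] nm by (simp add: parity_seq_def n_def[symmetric])
qed

lemma subshift_flip: assumes "x \<in> subshift" shows "(\<lambda>j. 1 - x j) \<in> subshift"
  unfolding subshift_iff
proof
  fix N
  obtain a where a: "\<forall>j<N. x j = parity_seq (a + j)" using assms subshift_iff by blast
  define k where "k = a + N"
  have "1 - x j = parity_seq ((L (Suc k) - L k + a) + j)" if "j < N" for j
    using a that parity_seq_top_block[of "a + j" k] L_gt[of k] by (simp add: k_def add.assoc)
  then show "\<exists>a. \<forall>j<N. 1 - x j = parity_seq (a + j)" by blast
qed

text \<open>The initial block of level \<open>k\<close> recurs with bounded gaps: every aligned block of level \<open>k + 1\<close> contains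
  it, at the front if the block is not complemented and at the end if it is.\<close>

lemma parity_seq_recurs: "\<exists>b. a \<le> b \<and> b + L k \<le> a + 2 * L (Suc k) \<and> (\<forall>i<L k. parity_seq (b + i) = parity_seq i)"
proof -
  have le: "L k \<le> L (Suc k)" using L_Suc_ge[of k] by simp
  \<comment> \<open>The first block of level \<open>k + 1\<close> that begins at or after position \<open>a\<close> begins at \<open>c\<close>.\<close>
  define q where "q = (a + L (Suc k) - 1) div L (Suc k)"
  define c where "c = q * L (Suc k)"
  have c1: "a \<le> c" "c + L (Suc k) \<le> a + 2 * L (Suc k)"
  proof -
    have "a + L (Suc k) - 1 < Suc q * L (Suc k)"
      unfolding q_def by (metis L_pos dividend_less_div_times mult_Suc add.commute)
    then show "a \<le> c" by (simp add: c_def)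
    have "c \<le> a + L (Suc k) - 1" unfolding c_def q_def by simp
    then show "c + L (Suc k) \<le> a + 2 * L (Suc k)" by simp
  qed
  have blk: "parity_seq (c + i) = (if high_parity (Suc k) c then 1 - parity_seq i else parity_seq i)" if "i < L (Suc k)" for i
  proof -
    have "(c + i) mod L (Suc k) = i" "(c + i) div L (Suc k) = c div L (Suc k)"
      using that by (simp_all add: c_def)
    then show ?thesis using parity_block[of "c + i" "Suc k"] high_parity_cong[of "c + i" "Suc k" c]
      by (simp add: parity_seq_def)
  qed
  show ?thesis
  proof (cases "high_parity (Suc k) c")
    case False
    then show ?thesis using blk c1 le by (intro exI[of _ c]) auto
  next
    case True
    have "parity_seq (c + (L (Suc k) - L k) + i) = parity_seq i" if "i < L k" for i
      using blk[of "L (Suc k) - L k + i"] True that le parity_seq_top_block[OF that] parity_seq_01[of i]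
      by (auto simp: add.assoc)
    then show ?thesis using c1 le by (intro exI[of _ "c + (L (Suc k) - L k)"]) auto
  qed
qed

text \<open>By bounded recurrence, long windows of any point \<open>x\<close> of the space contain every word of the
  generating sequence, hence every window of any other point.\<close>

lemma minimal_subshift: "minimal_shift_space {0, 1} subshift"
  unfolding minimal_shift_space_def
proof (intro conjI ballI shift_space_subshift)
  fix x assume x: "x \<in> subshift"
  have "y \<in> orbit_closure x" if y: "y \<in> subshift" for y
    unfolding orbit_closure_def
  proof clarify
    fix N
    obtain a where a: "\<forall>j<N. y j = parity_seq (a + j)" using y subshift_iff by blast
    define k where "k = a + N"
    obtain c where c: "\<forall>j<2 * L (Suc k). x j = parity_seq (c + j)" using x subshift_iff by blast
    obtain b where b: "c \<le> b" "b + L k \<le> c + 2 * L (Suc k)" "\<forall>i<L k. parity_seq (b + i) = parity_seq i"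
      using parity_seq_recurs by blast
    have "y j = x (b - c + a + j)" if "j < N" for j
    proof -
      have "a + j < L k" using that L_gt[of k] by (simp add: k_def)
      then have "x (b - c + (a + j)) = parity_seq (c + (b - c + (a + j)))" using b c by auto
      also have "\<dots> = parity_seq (a + j)" using b \<open>a + j < L k\<close> by (simp add: add.assoc[symmetric]) (simp add: add.assoc)
      finally show ?thesis using a that by (simp add: add.assoc)
    qed
    then show "\<exists>a. \<forall>j<N. y j = x (a + j)" by blast
  qed
  then show "subshift \<subseteq> closure {(shift ^^ n) x |n. True}"
    unfolding orbit_closure_eq[symmetric] by blast
qed

section \<open>Every invariant measure is close to a mixture of the point masses\<close>

text \<open>Whether ones prevail among the first \<open>L k\<close> letters. Near a generic position this recovers the type of
  the level-\<open>k\<close> block without having to locate the block boundaries.\<close>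

definition majority :: "nat \<Rightarrow> (nat \<Rightarrow> nat) \<Rightarrow> bool" where
  "majority k x \<longleftrightarrow> L k < 2 * card {j. j < L k \<and> x j = 1}"

lemma majority_parity_seq:
  assumes "high_parity k a = high_parity k (a + L k)"
  shows "majority k ((shift ^^ a) parity_seq) = high_parity k a"
proof -
  have "card {j. j < L k \<and> parity_seq (a + j) = 1} = card {j \<in> {a..<a + L k}. parity j}"
    by (rule bij_betw_same_card[of "\<lambda>j. a + j"],
        rule bij_betw_byWitness[where f' = "\<lambda>j. j - a"]) (auto simp: parity_seq_def)
  then show ?thesis
    using ones_window[OF assms] ones_less[of k] by (auto simp: majority_def shift_funpow)
qed

text \<open>With three blocks of room before the end of the level-\<open>k + 1\<close> block, the windows starting at \<open>a\<close>
  and at \<open>a + 1\<close> both stay among blocks of the surrounding type.\<close>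

lemma majority_parity_seq_next:
  assumes "a mod L (Suc k) + 3 * L k < L (Suc k)"
  shows "majority k ((shift ^^ a) parity_seq) = high_parity (Suc k) a"
    and "majority k ((shift ^^ Suc a) parity_seq) = high_parity (Suc k) a"
proof -
  have p: "0 < L k" by simp
  have 1: "high_parity k (a + i) = high_parity (Suc k) a" if "i \<le> Suc (L k)" for i
    using assms that p by (intro high_parity_next) linarith
  show "majority k ((shift ^^ a) parity_seq) = high_parity (Suc k) a"
    using majority_parity_seq[of k a] 1[of 0] 1[of "L k"] by simp
  show "majority k ((shift ^^ Suc a) parity_seq) = high_parity (Suc k) a"
    using majority_parity_seq[of k "Suc a"] 1[of 1] 1[of "Suc (L k)"] by (simp del: funpow.simps)
qed

lemma majority_cong: "(\<And>j. j < L k \<Longrightarrow> x j = y j) \<Longrightarrow> majority k x = majority k y"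
proof -
  assume "\<And>j. j < L k \<Longrightarrow> x j = y j"
  then have "{j. j < L k \<and> x j = 1} = {j. j < L k \<and> y j = 1}" by auto
  then show "majority k x = majority k y" by (simp add: majority_def)
qed

lemma measurable_majority [measurable]: "Measurable.pred borel (majority k)"
proof -
  have "open {x. majority k x}"
    by (rule open_finite_window[of _ "L k"]) (use majority_cong in blast)
  then have "{x. majority k x} \<in> sets borel" by simp
  then show ?thesis by (simp add: pred_def)
qed

text \<open>The points where the majority changes with the level or under one application of the shift. Including
  both kinds of change makes the limiting majority shift-invariant.\<close>

definition jump :: "nat \<Rightarrow> (nat \<Rightarrow> nat) set" where
  "jump k = {x. majority k x \<noteq> majority (Suc k) x \<or> majority k x \<noteq> majority k (shift x)}"

lemma sets_jump [measurable]: "jump k \<in> sets borel"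
proof -
  have "{x \<in> space borel. majority k x \<noteq> majority (Suc k) x \<or> majority k x \<noteq> majority k (shift x)} \<in> sets borel"
    by measurable
  then show ?thesis by (simp add: jump_def)
qed

lemma no_jump_parity_seq:
  assumes 1: "n mod L (Suc k) + 3 * L k < L (Suc k)"
    and 2: "n mod L (Suc (Suc k)) + 3 * L (Suc k) < L (Suc (Suc k))"
  shows "(shift ^^ n) parity_seq \<notin> jump k"
proof -
  have "high_parity (Suc k) n = high_parity (Suc (Suc k)) n" using 2 by (intro high_parity_block) simp
  then show ?thesis using majority_parity_seq_next[OF 1] majority_parity_seq_next[OF 2] by (simp add: jump_def)
qed

text \<open>Along the generating sequence, jumps happen only within three blocks of the end of a block of the next
  level, at one of the two levels that are involved. A single period of length \<open>L (k + 2)\<close> suffices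
  to count them.\<close>

lemma jump_visits:
  assumes "x \<in> subshift"
  shows "card {j. j < L (Suc (Suc k)) \<and> (shift ^^ j) x \<in> jump k} \<le> 3 * m (Suc k) * L k + 3 * L (Suc k)"
proof -
  define P where "P = L (Suc (Suc k))"
  define bad where "bad i n \<longleftrightarrow> L (Suc i) \<le> n mod L (Suc i) + 3 * L i" for i n
  have le: "L k \<le> L (Suc k)" "L (Suc k) \<le> P" using L_Suc_ge[of k] L_Suc_ge[of "Suc k"] by (auto simp: P_def)
  \<comment> \<open>Three periods cover the windows of both levels that start at positions up to \<open>P\<close>.\<close>
  obtain a where a: "\<And>j. j < P + P + P \<Longrightarrow> x j = parity_seq (a + j)" using assms subshift_iff by blast
  have eq: "majority i ((shift ^^ j) x) = majority i ((shift ^^ (a + j)) parity_seq)"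
    if "j \<le> P" "i \<in> {k, Suc k}" for i j
    using that le a by (intro majority_cong) (auto simp: shift_funpow add.assoc)
  have "{j. j < P \<and> (shift ^^ j) x \<in> jump k} \<subseteq> {j. j < P \<and> (bad k (a + j) \<or> bad (Suc k) (a + j))}"
  proof clarify
    fix j assume j: "j < P" "(shift ^^ j) x \<in> jump k" "\<not> bad (Suc k) (a + j)"
    have "(shift ^^ (a + j)) parity_seq \<in> jump k"
      using j(1,2) eq[of j k] eq[of j "Suc k"] eq[of "Suc j" k] by (simp add: jump_def)
    then show "bad k (a + j)"
      using no_jump_parity_seq[of "a + j" k] j(3) unfolding bad_def not_le by (metis not_le)
  qed
  then have "card {j. j < P \<and> (shift ^^ j) x \<in> jump k} \<le> card {j. j < P \<and> (bad k (a + j) \<or> bad (Suc k) (a + j))}"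
    by (intro card_mono) auto
  also have "\<dots> = card {n \<in> {a..<a + P}. bad k n \<or> bad (Suc k) n}"
    by (rule bij_betw_same_card[of "\<lambda>j. a + j"],
        rule bij_betw_byWitness[where f' = "\<lambda>j. j - a"]) auto
  also have "\<dots> \<le> card {n \<in> {a..<a + P}. bad k n} + card {n \<in> {a..<a + P}. bad (Suc k) n}"
    by (rule order_trans[OF card_mono card_Un_le]) auto
  also have "\<dots> \<le> m (Suc k) * (3 * L k) + 1 * (3 * L (Suc k))"
  proof (rule add_mono)
    show "card {n \<in> {a..<a + P}. bad k n} \<le> m (Suc k) * (3 * L k)"
      unfolding bad_def P_def L_Suc[of "Suc k"] by (rule card_mod_near_period_le) simp
    show "card {n \<in> {a..<a + P}. bad (Suc k) n} \<le> 1 * (3 * L (Suc k))"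
      using card_mod_near_period_le[of P a 1 "3 * L (Suc k)"] by (simp add: bad_def P_def)
  qed
  finally show ?thesis by (simp add: P_def)
qed

lemma measure_jump_le:
  assumes "M \<in> shift_measures subshift"
  shows "measure M (jump k) \<le> 3 / real (m k) + 3 / real (m (Suc k))"
proof -
  have pos: "0 < real (m k)" "0 < real (m (Suc k))" "0 < real (L k)"
    using m_ge[of k] m_ge[of "Suc k"] by auto
  have "real (L (Suc (Suc k))) * measure M (jump k) \<le> real (3 * m (Suc k) * L k + 3 * L (Suc k))"
    by (rule measure_le_visit_frequency[OF assms closed_subshift sets_jump]) (rule jump_visits)
  then have "real (L k) * (real (m k) * real (m (Suc k)) * measure M (jump k)) \<le>
      real (L k) * (3 * real (m (Suc k)) + 3 * real (m k))"
    by (simp add: L_Suc algebra_simps)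
  then have "real (m k) * real (m (Suc k)) * measure M (jump k) \<le> 3 * real (m (Suc k)) + 3 * real (m k)"
    using pos(3) by (simp only: mult_le_cancel_left_pos)
  then show ?thesis using pos by (simp add: field_simps)
qed

lemma sum_jump_bound: "(\<Sum>k<K. 3 / real (m k) + 3 / real (m (Suc k))) \<le> 6 * e"
proof -
  have "(\<Sum>k<K. 1 / real (m (Suc k))) \<le> (\<Sum>k<Suc K. 1 / real (m k))"
    unfolding sum.lessThan_Suc_shift by simp
  then have "(\<Sum>k<K. 1 / real (m (Suc k))) \<le> e" using sum_le[of "Suc K"] by linarith
  moreover have "(\<Sum>k<K. 3 / real (m k) + 3 / real (m (Suc k))) =
      3 * (\<Sum>k<K. 1 / real (m k)) + 3 * (\<Sum>k<K. 1 / real (m (Suc k)))"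
    by (simp add: sum.distrib sum_distrib_left)
  ultimately show ?thesis using sum_le[of K] by linarith
qed

text \<open>The limit of the majorities as the level grows, where it exists; otherwise \<open>False\<close>. It plays the part of
  the ergodic component of \<open>x\<close>.\<close>

definition mode :: "(nat \<Rightarrow> nat) \<Rightarrow> bool" where
  "mode x \<longleftrightarrow> (\<exists>K. \<forall>k\<ge>K. majority k x)"

lemma measurable_mode [measurable]: "Measurable.pred borel mode"
  unfolding mode_def by measurable

lemma measurable_const_mode [measurable]: "(\<lambda>x. const_seq (mode x)) \<in> borel_measurable borel"
proof -
  have "(\<lambda>x. if mode x then const_seq True else const_seq False) \<in> borel_measurable borel"
    by measurable
  moreover have "(\<lambda>x. if mode x then const_seq True else const_seq False) = (\<lambda>x. const_seq (mode x))"
    by auto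
  ultimately show ?thesis by simp
qed

text \<open>The window of level 0 has length \<open>L 0 = 1\<close>, so its majority is the first letter; without jumps this
  is the majority at all levels.\<close>

lemma mode_eq_first:
  assumes "\<And>k. x \<notin> jump k" shows "mode x \<longleftrightarrow> x 0 = 1"
proof -
  have "majority k x = majority 0 x" for k
  proof (induction k)
    case (Suc k)
    then show ?case using assms[of k] by (simp add: jump_def)
  qed simp
  then have "mode x = majority 0 x" by (auto simp: mode_def)
  also have "{j. j < L 0 \<and> x j = 1} = (if x 0 = 1 then {0} else {})" by auto
  then have "majority 0 x \<longleftrightarrow> x 0 = 1" by (simp add: majority_def)
  finally show ?thesis .
qed

text \<open>The joining is the law of the pair formed by a point and the constant sequence of its mode. It is
  invariant because the mode is, almost everywhere.\<close>

lemma subshift_measure_near_two_points: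
  assumes M: "M \<in> shift_measures subshift"
  shows "\<exists>N\<in>shift_measures two_points. dbar_measure M N \<le> ereal (6 * e)"
proof -
  interpret prob_space M using M by (simp add: shift_measures_iff)
  have sets [measurable_cong]: "sets M = sets borel" and inv: "distr M borel shift = M"
    and MX: "emeasure M subshift = 1"
    using M by (auto simp: shift_measures_iff)
  have sp: "space M = UNIV" using sets_eq_imp_space_eq[OF sets] by simp
  have sum: "summable (\<lambda>k. measure M (jump k))"
    and tot: "(\<Sum>k. measure M (jump k)) \<le> 6 * e"
  proof -
    have b: "(\<Sum>k<K. measure M (jump k)) \<le> 6 * e" for K
      using sum_mono[of "{..<K}", OF measure_jump_le[OF M]] sum_jump_bound[of K] by (meson order_trans)
    then show "summable (\<lambda>k. measure M (jump k))"
      by (intro summableI_nonneg_bounded[of _ "6 * e"]) auto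
    then show "(\<Sum>k. measure M (jump k)) \<le> 6 * e" using b by (intro suminf_le_const)
  qed
  \<comment> \<open>The mode is determined by the majorities of high levels, which almost everywhere do not jump.\<close>
  have AE_inv: "AE x in M. mode (shift x) = mode x"
  proof -
    have "AE x in M. eventually (\<lambda>k. x \<in> space M - jump k) sequentially"
      using sum by (intro borel_cantelli_AE1) (auto simp: sets emeasure_eq_measure)
    then show ?thesis
    proof eventually_elim
      case (elim x)
      then have "\<forall>\<^sub>F k in sequentially. majority k (shift x) = majority k x"
        by (rule eventually_mono) (unfold jump_def, blast)
      then show ?case
        unfolding mode_def eventually_sequentially[symmetric] by (rule eventually_subst)
    qed
  qed
  define G where "G = (\<lambda>x. (x, const_seq (mode x)))"
  have G' [measurable]: "G \<in> borel_measurable borel"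
    unfolding G_def borel_prod[symmetric] by measurable
  have G: "G \<in> borel_measurable M"
    using G' unfolding measurable_cong_sets[OF sets refl] .
  define J where "J = distr M borel G"
  define N where "N = distr M borel (\<lambda>x. const_seq (mode x))"
  have JM: "distr J borel fst = M"
  proof -
    have "distr J borel fst = distr M borel (fst \<circ> G)"
      unfolding J_def by (rule distr_distr[OF _ G]) (simp add: borel_prod[symmetric])
    also have "fst \<circ> G = (\<lambda>x. x)" by (auto simp: G_def)
    also have "distr M borel (\<lambda>x. x) = M" using sets by (intro distr_id2) simp
    finally show ?thesis .
  qed
  have JN: "distr J borel snd = N"
  proof -
    have "distr J borel snd = distr M borel (snd \<circ> G)"
      unfolding J_def by (rule distr_distr[OF _ G]) (simp add: borel_prod[symmetric])
    then show ?thesis by (simp add: N_def G_def comp_def)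
  qed
  have Jinv: "distr J borel (map_prod shift shift) = J"
  proof -
    have "distr J borel (map_prod shift shift) = distr M borel (map_prod shift shift \<circ> G)"
      unfolding J_def by (rule distr_distr) auto
    also have "\<dots> = distr M borel (G \<circ> shift)"
    proof (rule distr_cong_AE)
      show "AE x in M. (map_prod shift shift \<circ> G) x = (G \<circ> shift) x"
        using AE_inv by eventually_elim (simp add: G_def)
    qed (use G' in measurable)
    also have "\<dots> = distr (distr M borel shift) borel G"
      using G' by (intro distr_distr[symmetric]) auto
    also have "\<dots> = J" by (simp add: inv J_def)
    finally show ?thesis .
  qed
  have "J \<in> joinings M N"
    using JM JN Jinv prob_space_distr[OF G] by (simp add: joinings_def invariant_measures_def J_def)
  then have 1: "dbar_measure M N \<le> ereal (measure J {(x, y). x 0 \<noteq> y 0})"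
    unfolding dbar_measure_def by (rule INF_lower)
  have 2: "measure J {(x, y). x 0 \<noteq> y 0} \<le> 6 * e"
  proof -
    have "measure J {(x, y). x 0 \<noteq> y 0} = measure M (G -` {(x, y). x 0 \<noteq> y 0})"
      unfolding J_def by (subst measure_distr) (auto simp: sp)
    also have "\<dots> \<le> measure M (\<Union>k. jump k)"
    proof (rule finite_measure_mono_AE)
      have "AE x in M. x \<in> subshift" using MX closed_subshift sets by (intro AE_I_eq_1) (auto simp: sp)
      then show "AE x in M. x \<in> G -` {(x, y). x 0 \<noteq> y 0} \<longrightarrow> x \<in> (\<Union>k. jump k)"
      proof eventually_elim
        case (elim x)
        have "subshift \<subseteq> full_shift {0, 1}" using shift_space_subshift by (simp add: shift_space_def)
        then have "x 0 \<in> {0, 1}" using elim by (auto simp: full_shift_def)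
        then show ?case using mode_eq_first[of x] by (auto simp: G_def const_seq_def)
      qed
    qed (simp add: sets)
    also have "\<dots> \<le> (\<Sum>k. measure M (jump k))"
      using sum by (intro finite_measure_subadditive_countably) (auto simp: sets)
    finally show ?thesis using tot by simp
  qed
  have "dbar_measure M N \<le> ereal (6 * e)"
    using order_trans[OF 1] 2 by simp
  moreover have "N \<in> shift_measures two_points"
    unfolding shift_measures_iff
  proof (intro conjI)
    show "prob_space N" unfolding N_def by (rule prob_space_distr) simp
    show "sets N = sets borel" by (simp add: N_def)
    have "distr N borel shift = distr M borel (shift \<circ> (\<lambda>x. const_seq (mode x)))"
      unfolding N_def by (rule distr_distr) auto
    then show "distr N borel shift = N" by (simp add: N_def comp_def)
    have "closed two_points" using shift_space_two_points by (simp add: shift_space_def)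
    then have "emeasure N two_points = emeasure M ((\<lambda>x. const_seq (mode x)) -` two_points \<inter> space M)"
      unfolding N_def by (intro emeasure_distr) auto
    also have "(\<lambda>x. const_seq (mode x)) -` two_points \<inter> space M = space M" by auto
    finally show "emeasure N two_points = 1" by (simp add: emeasure_space_1)
  qed
  ultimately show ?thesis by blast
qed

section \<open>An invariant measure concentrated near the zero sequence\<close>

abbreviation digit_measure :: "nat \<Rightarrow> nat measure" where
  "digit_measure k \<equiv> measure_pmf (pmf_of_set {..<m k})"

definition digit_seqs :: "(nat \<Rightarrow> nat) measure" where
  "digit_seqs = PiM UNIV digit_measure"

text \<open>The number with the first \<open>k\<close> digits \<open>\<omega>\<close>. For independent uniform digits it is uniform on
  \<open>{..<L k}\<close> (\<open>prob_digit_sum\<close>).\<close>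

definition digit_sum :: "nat \<Rightarrow> (nat \<Rightarrow> nat) \<Rightarrow> nat" where
  "digit_sum k \<omega> = (\<Sum>i<k. \<omega> i * L i)"

text \<open>The limit of the shifts of \<open>parity\<close> by \<open>digit_sum k \<omega>\<close>; coordinates at which these do not
  converge get the value 0.\<close>

definition limit_seq :: "(nat \<Rightarrow> nat) \<Rightarrow> nat \<Rightarrow> nat" where
  "limit_seq \<omega> j = of_bool (\<exists>K. \<forall>k\<ge>K. parity (digit_sum k \<omega> + j))"

lemma digit_range_nonempty [simp]: "{..<m k} \<noteq> {}"
  using m_ge[of k] by (auto simp: lessThan_empty_iff)

lemma product_prob_space_digit_measure: "product_prob_space digit_measure"
  by (rule product_prob_spaceI) (rule measure_pmf.prob_space_axioms)

lemma prob_space_digit_seqs: "prob_space digit_seqs"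
  unfolding digit_seqs_def by (rule prob_space_PiM) (rule measure_pmf.prob_space_axioms)

lemma space_digit_seqs [simp]: "space digit_seqs = UNIV"
  by (simp add: digit_seqs_def space_PiM)

lemma measurable_digit: "(\<lambda>\<omega>. f (\<omega> i)) \<in> digit_seqs \<rightarrow>\<^sub>M count_space UNIV"
proof -
  have "(\<lambda>\<omega>. \<omega> i) \<in> digit_seqs \<rightarrow>\<^sub>M count_space UNIV"
    using measurable_component_singleton[of i UNIV digit_measure] by (simp add: digit_seqs_def)
  then show ?thesis by (rule measurable_compose) simp
qed

lemma measurable_digit_sum [measurable]: "digit_sum k \<in> digit_seqs \<rightarrow>\<^sub>M count_space UNIV"
proof -
  have "(\<lambda>\<omega>. \<omega> i * L i) \<in> borel_measurable digit_seqs" for i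
    using measurable_digit[of "\<lambda>n. n * L i" i]
    by (simp add: measurable_cong_sets[OF refl sets_borel_eq_count_space])
  then have "digit_sum k \<in> borel_measurable digit_seqs"
    unfolding digit_sum_def by (intro borel_measurable_sum)
  then show ?thesis by (simp add: measurable_cong_sets[OF refl sets_borel_eq_count_space])
qed

lemma measurable_limit_seq [measurable]: "limit_seq \<in> borel_measurable digit_seqs"
proof (rule measurable_coordinatewise_then_product)
  fix j
  have "Measurable.pred digit_seqs (\<lambda>\<omega>. parity (digit_sum k \<omega> + j))" for k
    by (rule measurable_compose[OF measurable_digit_sum[of k]]) simp
  then have [measurable]: "Measurable.pred digit_seqs (\<lambda>\<omega>. \<exists>K. \<forall>k\<ge>K. parity (digit_sum k \<omega> + j))"
    by measurable
  show "(\<lambda>\<omega>. limit_seq \<omega> j) \<in> borel_measurable digit_seqs"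
    unfolding limit_seq_def by measurable
qed

lemma digit_sum_eq: "(\<And>i. i < k \<Longrightarrow> \<omega> i = (d div L i) mod m i) \<Longrightarrow> digit_sum k \<omega> = d mod L k"
proof (induction k)
  case (Suc k)
  then have "digit_sum k \<omega> = d mod L k" by simp
  then show ?case using Suc.prems[of k] by (simp add: digit_sum_def mod_L_Suc)
qed (simp add: digit_sum_def)

lemma prob_digit_sum_ge:
  assumes "d < L k" shows "1 / real (L k) \<le> measure digit_seqs {\<omega>. digit_sum k \<omega> = d}"
proof -
  interpret P: product_prob_space digit_measure UNIV by (rule product_prob_space_digit_measure)
  interpret prob_space digit_seqs by (rule prob_space_digit_seqs)
  define W where "W i = {(d div L i) mod m i}" for i
  have "emeasure digit_seqs {\<omega> \<in> space digit_seqs. \<forall>i\<in>{..<k}. \<omega> i \<in> W i} =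
      (\<Prod>i<k. emeasure (digit_measure i) (W i))"
    unfolding digit_seqs_def by (rule P.emeasure_PiM_Collect) auto
  also have "\<dots> = (\<Prod>i<k. ennreal (1 / real (m i)))"
  proof (rule prod.cong[OF refl])
    fix i
    have "(d div L i) mod m i < m i" using m_ge[of i] by simp
    then have "{..<m i} \<inter> W i = W i" by (auto simp: W_def)
    then show "emeasure (digit_measure i) (W i) = ennreal (1 / real (m i))"
      by (subst emeasure_pmf_of_set) (auto simp: W_def)
  qed
  also have "\<dots> = ennreal (1 / real (L k))"
    by (simp add: prod_ennreal L_def prod_dividef)
  finally have "1 / real (L k) = measure digit_seqs {\<omega> \<in> space digit_seqs. \<forall>i\<in>{..<k}. \<omega> i \<in> W i}"
    by (simp add: emeasure_eq_measure)
  also have "\<dots> \<le> measure digit_seqs {\<omega>. digit_sum k \<omega> = d}"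
  proof (rule finite_measure_mono)
    show "{\<omega> \<in> space digit_seqs. \<forall>i\<in>{..<k}. \<omega> i \<in> W i} \<subseteq> {\<omega>. digit_sum k \<omega> = d}"
      using digit_sum_eq[of k _ d] assms by (auto simp: W_def)
    have "digit_sum k -` {d} \<inter> space digit_seqs \<in> sets digit_seqs" 
      by (rule measurable_sets[OF measurable_digit_sum]) simp
    then show "{\<omega>. digit_sum k \<omega> = d} \<in> sets digit_seqs" by (simp add: vimage_def)
  qed
  finally show ?thesis .
qed

text \<open>Each value below \<open>L k\<close> has probability at least \<open>1 / L k\<close>. This bounds the probability of \<open>E\<close>
  from below, and applied to the complement of \<open>E\<close> also from above, as these lower bounds already
  add up to 1.\<close>

lemma prob_digit_sum:
  "measure digit_seqs {\<omega>. digit_sum k \<omega> \<in> E} = real (card {d. d < L k \<and> d \<in> E}) / real (L k)"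
proof -
  interpret prob_space digit_seqs by (rule prob_space_digit_seqs)
  have meas: "{\<omega>. digit_sum k \<omega> \<in> E} \<in> sets digit_seqs" for E
    using measurable_sets[OF measurable_digit_sum[of k], of E] by (simp add: vimage_def)
  have ge: "real (card {d. d < L k \<and> d \<in> E}) / real (L k) \<le> measure digit_seqs {\<omega>. digit_sum k \<omega> \<in> E}" for E
  proof -
    define F where "F = {d. d < L k \<and> d \<in> E}"
    have "real (card F) / real (L k) = (\<Sum>d\<in>F. 1 / real (L k))" by simp
    also have "\<dots> \<le> (\<Sum>d\<in>F. measure digit_seqs {\<omega>. digit_sum k \<omega> = d})"
      by (rule sum_mono) (auto simp: F_def intro: prob_digit_sum_ge)
    also have "\<dots> = measure digit_seqs (\<Union>d\<in>F. {\<omega>. digit_sum k \<omega> = d})"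
      using meas[of "{_}"] by (intro finite_measure_finite_Union[symmetric])
        (auto simp: F_def disjoint_family_on_def)
    also have "\<dots> \<le> measure digit_seqs {\<omega>. digit_sum k \<omega> \<in> E}"
      by (rule finite_measure_mono[OF _ meas]) (auto simp: F_def)
    finally show ?thesis by (simp add: F_def)
  qed
  have "{d. d < L k \<and> d \<in> E} \<union> {d. d < L k \<and> d \<in> - E} = {..<L k}" by auto
  moreover have "card ({d. d < L k \<and> d \<in> E} \<union> {d. d < L k \<and> d \<in> - E}) =
      card {d. d < L k \<and> d \<in> E} + card {d. d < L k \<and> d \<in> - E}"
    by (rule card_Un_disjoint) auto
  ultimately have "real (card {d. d < L k \<and> d \<in> E}) + real (card {d. d < L k \<and> d \<in> - E}) = real (L k)"
    by (metis card_lessThan of_nat_add)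
  then have "real (card {d. d < L k \<and> d \<in> E}) / real (L k) + real (card {d. d < L k \<and> d \<in> - E}) / real (L k) = 1"
    by (simp add: add_divide_distrib[symmetric])
  moreover have "measure digit_seqs {\<omega>. digit_sum k \<omega> \<in> - E} = 1 - measure digit_seqs {\<omega>. digit_sum k \<omega> \<in> E}"
  proof -
    have "{\<omega>. digit_sum k \<omega> \<in> - E} = space digit_seqs - {\<omega>. digit_sum k \<omega> \<in> E}" by auto
    then show ?thesis using prob_compl[OF meas] by simp
  qed
  ultimately show ?thesis using ge[of E] ge[of "- E"] by linarith
qed

text \<open>Borel--Cantelli: the \<open>k\<close>th digit is maximal with probability \<open>1 / m k\<close>, and these are summable.\<close>

lemma AE_digits_not_top: "AE \<omega> in digit_seqs. \<forall>\<^sub>F k in sequentially. Suc (\<omega> k) < m k"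
proof -
  interpret P: product_prob_space digit_measure UNIV by (rule product_prob_space_digit_measure)
  interpret prob_space digit_seqs by (rule prob_space_digit_seqs)
  define B where "B k = {\<omega> \<in> space digit_seqs. \<omega> k \<in> {n. m k \<le> Suc n}}" for k
  have B: "B k \<in> sets digit_seqs" for k
    using measurable_sets[OF measurable_digit[of "\<lambda>n. n" k], of "{n. m k \<le> Suc n}"]
    by (simp add: B_def vimage_def)
  have "measure digit_seqs (B k) = 1 / real (m k)" for k
  proof -
    have "emeasure digit_seqs (B k) = emeasure (digit_measure k) {n. m k \<le> Suc n}"
      unfolding B_def digit_seqs_def by (rule P.emeasure_PiM_Collect_single) auto
    moreover have "{..<m k} \<inter> {n. m k \<le> Suc n} = {m k - 1}" using m_ge[of k] by auto
    ultimately have "emeasure digit_seqs (B k) = ennreal (1 / real (m k))"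
      by (subst (asm) emeasure_pmf_of_set) auto
    then show ?thesis by (simp add: emeasure_eq_measure)
  qed
  then have "summable (\<lambda>k. measure digit_seqs (B k))"
    using sum_le by (intro summableI_nonneg_bounded[of _ e]) auto
  then have "AE \<omega> in digit_seqs. \<forall>\<^sub>F k in sequentially. \<omega> \<in> space digit_seqs - B k"
    using B by (intro borel_cantelli_AE1) (auto simp: emeasure_eq_measure)
  then show ?thesis
    by eventually_elim (auto simp: B_def elim!: eventually_mono)
qed

text \<open>Once no digit is maximal any more, the gap between \<open>digit_sum k \<omega>\<close> and \<open>L k\<close> tends to infinity. As soon
  as it exceeds \<open>j\<close>, position \<open>digit_sum k \<omega> + j\<close> involves only the first \<open>k\<close> digits, and the next digit
  adds a multiple of \<open>L k\<close> without a carry and without a change of parity.\<close>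

lemma limit_seq_eventually:
  assumes "\<forall>\<^sub>F k in sequentially. Suc (\<omega> k) < m k"
  shows "\<forall>\<^sub>F k in sequentially. limit_seq \<omega> j = parity_seq (digit_sum k \<omega> + j)"
proof -
  obtain K where K: "\<And>k. K \<le> k \<Longrightarrow> Suc (\<omega> k) < m k"
    using assms by (auto simp: eventually_sequentially)
  \<comment> \<open>From level \<open>K\<close> on, \<open>L k - digit_sum k \<omega>\<close> grows by at least 1 with each level.\<close>
  have room: "int (digit_sum (K + i) \<omega>) + int i \<le> int (L (K + i)) + int (digit_sum K \<omega>)" for i
  proof (induction i)
    case (Suc i)
    have "Suc (Suc (\<omega> (K + i))) * L (K + i) \<le> m (K + i) * L (K + i)"
      using K[of "K + i"] by (intro mult_right_mono) auto
    then have "digit_sum (K + Suc i) \<omega> + 2 * L (K + i) \<le> digit_sum (K + i) \<omega> + L (K + Suc i)"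
      by (simp add: digit_sum_def L_Suc)
    then show ?case using Suc L_pos[of "K + i"] by linarith
  qed simp
  define K' where "K' = K + Suc (digit_sum K \<omega> + j)"
  have lt: "digit_sum k \<omega> + j < L k" if "K' \<le> k" for k
    using room[of "k - K"] that by (simp add: K'_def)
  have step: "parity (digit_sum (Suc k) \<omega> + j) = parity (digit_sum k \<omega> + j)" if k: "K' \<le> k" for k
  proof -
    define n where "n = digit_sum (Suc k) \<omega> + j"
    have n: "n = (digit_sum k \<omega> + j) + \<omega> k * L k" by (simp add: n_def digit_sum_def)
    then have "n mod L k = digit_sum k \<omega> + j" "n div L k = \<omega> k" using lt[OF k] by simp_all
    moreover have "n < L (Suc k)" using lt[of "Suc k"] k by (simp add: n_def)
    moreover have "\<omega> k mod m k \<noteq> m k - 1" using K[of k] k by (simp add: K'_def)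
    ultimately have "parity n = parity (digit_sum k \<omega> + j)"
      using parity_block[of n k] high_parity_Suc[of k n] high_parity_eq_False[of n "Suc k"] by (simp add: top_digit_def)
    then show ?thesis by (simp add: n_def)
  qed
  have const: "parity (digit_sum k \<omega> + j) = parity (digit_sum K' \<omega> + j)" if "K' \<le> k" for k
    using that by (induction k rule: dec_induct) (use step in auto)
  have "limit_seq \<omega> j = of_bool (parity (digit_sum K' \<omega> + j))"
  proof -
    have "(\<exists>K. \<forall>k\<ge>K. parity (digit_sum k \<omega> + j)) = parity (digit_sum K' \<omega> + j)"
      by (metis const nat_le_linear order_refl)
    then show ?thesis by (simp add: limit_seq_def)
  qed
  then have "limit_seq \<omega> j = parity_seq (digit_sum k \<omega> + j)" if "K' \<le> k" for k
    using const[OF that] by (simp add: parity_seq_def)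
  then show ?thesis by (auto simp: eventually_sequentially)
qed

lemma limit_seq_window:
  assumes "\<forall>\<^sub>F k in sequentially. Suc (\<omega> k) < m k"
  shows "\<forall>\<^sub>F k in sequentially. \<forall>j<N. limit_seq \<omega> j = (shift ^^ digit_sum k \<omega>) parity_seq j"
proof -
  have "\<forall>\<^sub>F k in sequentially. \<forall>j\<in>{..<N}. limit_seq \<omega> j = parity_seq (digit_sum k \<omega> + j)"
    by (rule eventually_ball_finite) (use limit_seq_eventually[OF assms] in auto)
  then show ?thesis by (rule eventually_mono) (auto simp: shift_funpow)
qed

text \<open>The limit of the uniform distributions on the first \<open>L k\<close> shifts of the sequence, in the spirit of
  Krylov--Bogolyubov. Realizing these distributions on one probability space turns the weak limit into an
  almost sure one.\<close>

definition zero_measure :: "(nat \<Rightarrow> nat) measure" where "zero_measure = distr digit_seqs borel limit_seq"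

text \<open>The measure of an event about a finite window is the limit of its frequencies in the initial blocks:
  the events for the shifts by \<open>digit_sum k \<omega>\<close> converge almost surely, so dominated convergence applies.\<close>

lemma zero_measure_window_limit:
  assumes E: "\<And>x y. x \<in> E \<Longrightarrow> (\<And>j. j < N \<Longrightarrow> y j = x j) \<Longrightarrow> y \<in> E"
  shows "(\<lambda>k. real (card {d. d < L k \<and> (shift ^^ d) parity_seq \<in> E}) / real (L k)) \<longlonglongrightarrow> measure zero_measure E"
proof -
  interpret prob_space digit_seqs by (rule prob_space_digit_seqs)
  have "open E" by (rule open_finite_window) (use E in blast)
  then have Es: "E \<in> sets borel" by simp
  define F where "F = {d. (shift ^^ d) parity_seq \<in> E}"
  have mF: "{\<omega>. digit_sum k \<omega> \<in> F} \<in> sets digit_seqs" for k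
    using measurable_sets[OF measurable_digit_sum[of k], of F] by (simp add: vimage_def)
  have mE: "{\<omega>. limit_seq \<omega> \<in> E} \<in> sets digit_seqs"
    using measurable_sets[OF measurable_limit_seq Es] by (simp add: vimage_def)
  have "(\<lambda>k. \<integral>\<omega>. indicator {\<omega>. digit_sum k \<omega> \<in> F} \<omega> \<partial>digit_seqs) \<longlonglongrightarrow>
      (\<integral>\<omega>. (indicator {\<omega>. limit_seq \<omega> \<in> E} \<omega> :: real) \<partial>digit_seqs)"
  proof (rule integral_dominated_convergence[where w = "\<lambda>_. 1"])
    show "AE \<omega> in digit_seqs. (\<lambda>k. indicator {\<omega>. digit_sum k \<omega> \<in> F} \<omega>) \<longlonglongrightarrow>
        (indicator {\<omega>. limit_seq \<omega> \<in> E} \<omega> :: real)"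
      using AE_digits_not_top
    proof eventually_elim
      case (elim \<omega>)
      have "\<forall>\<^sub>F k in sequentially. (indicator {\<omega>. digit_sum k \<omega> \<in> F} \<omega> :: real) =
          indicator {\<omega>. limit_seq \<omega> \<in> E} \<omega>"
        using limit_seq_window[OF elim, of N]
      proof eventually_elim
        case (elim k)
        then have "digit_sum k \<omega> \<in> F \<longleftrightarrow> limit_seq \<omega> \<in> E"
          using E[of "limit_seq \<omega>" "(shift ^^ digit_sum k \<omega>) parity_seq"]
            E[of "(shift ^^ digit_sum k \<omega>) parity_seq" "limit_seq \<omega>"] by (auto simp: F_def)
        then show ?case by (simp add: indicator_def)
      qed
      then show ?case by (rule tendsto_eventually)
    qed
    show "AE \<omega> in digit_seqs. norm (indicator {\<omega>. digit_sum k \<omega> \<in> F} \<omega> :: real) \<le> 1" for k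
      by (simp add: indicator_def)
  qed (use mF mE in auto)
  then have "(\<lambda>k. measure digit_seqs {\<omega>. digit_sum k \<omega> \<in> F}) \<longlonglongrightarrow> measure digit_seqs {\<omega>. limit_seq \<omega> \<in> E}"
    using mF mE by simp
  moreover have "measure zero_measure E = measure digit_seqs {\<omega>. limit_seq \<omega> \<in> E}"
    unfolding zero_measure_def by (subst measure_distr) (auto simp: Es vimage_def)
  ultimately show ?thesis unfolding prob_digit_sum by (simp add: F_def)
qed

lemma prob_space_zero_measure: "prob_space zero_measure"
  unfolding zero_measure_def by (rule prob_space.prob_space_distr[OF prob_space_digit_seqs]) simp

lemma sets_zero_measure: "sets zero_measure = sets borel"
  by (simp add: zero_measure_def)

lemma inv_L_tendsto: "(\<lambda>k. 1 / real (L k)) \<longlonglongrightarrow> 0"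
proof (rule tendsto_sandwich[OF _ _ tendsto_const])
  show "(\<lambda>k. 1 / real (Suc k)) \<longlonglongrightarrow> 0" by (rule LIMSEQ_Suc[OF lim_1_over_n])
  show "\<forall>\<^sub>F k in sequentially. 1 / real (L k) \<le> 1 / real (Suc k)"
  proof (intro always_eventually allI)
    fix k
    have "real (Suc k) \<le> real (L k)" using L_gt[of k] by linarith
    then show "1 / real (L k) \<le> 1 / real (Suc k)" by (intro divide_left_mono) auto
  qed
qed auto

text \<open>The frequencies of \<open>E\<close> and of its preimage in the initial block of level \<open>k\<close> count the same
  occurrences except at the two ends.\<close>

lemma zero_measure_shift_window:
  assumes E: "\<And>x y. x \<in> E \<Longrightarrow> (\<And>j. j < N \<Longrightarrow> y j = x j) \<Longrightarrow> y \<in> E"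
  shows "measure zero_measure (shift -` E) = measure zero_measure E"
proof -
  define A where "A k = {d. d < L k \<and> (shift ^^ d) parity_seq \<in> E}" for k
  define B where "B k = {d. d < L k \<and> (shift ^^ d) parity_seq \<in> shift -` E}" for k
  have fin: "finite (A k)" "finite (B k)" for k by (auto simp: A_def B_def)
  have bound: "\<bar>real (card (B k)) / real (L k) - real (card (A k)) / real (L k)\<bar> \<le> 1 / real (L k)" for k
  proof -
    have *: "Suc ` B k \<subseteq> insert (L k) (A k)" "A k \<subseteq> insert 0 (Suc ` B k)"
    proof -
      show "Suc ` B k \<subseteq> insert (L k) (A k)" by (auto simp: A_def B_def)
      show "A k \<subseteq> insert 0 (Suc ` B k)"
      proof
        fix d assume "d \<in> A k"
        then show "d \<in> insert 0 (Suc ` B k)" by (cases d) (auto simp: A_def B_def image_iff)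
      qed
    qed
    have "card (B k) \<le> Suc (card (A k))"
      using card_mono[OF _ *(1)] fin card_insert_le_m1[of "Suc (card (A k))" "A k" "L k"]
      by (simp add: card_image)
    moreover have "card (A k) \<le> Suc (card (B k))"
      using card_mono[OF _ *(2)] fin by (simp add: card_image card_insert_if split: if_splits)
    ultimately have "\<bar>real (card (B k)) - real (card (A k))\<bar> \<le> 1" by linarith
    then show ?thesis
      by (simp add: diff_divide_distrib[symmetric] divide_right_mono)
  qed
  have a: "(\<lambda>k. real (card (A k)) / real (L k)) \<longlonglongrightarrow> measure zero_measure E"
    unfolding A_def by (rule zero_measure_window_limit) (use E in blast)
  have b: "(\<lambda>k. real (card (B k)) / real (L k)) \<longlonglongrightarrow> measure zero_measure (shift -` E)"
    unfolding B_def
  proof (rule zero_measure_window_limit[of _ "Suc N"])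
    fix x y assume "x \<in> shift -` E" "\<And>j. j < Suc N \<Longrightarrow> y j = x j"
    then show "y \<in> shift -` E" using E[of "shift x" "shift y"] by (auto simp: shift_def)
  qed
  have "(\<lambda>k. real (card (B k)) / real (L k) - real (card (A k)) / real (L k)) \<longlonglongrightarrow> 0"
    by (rule Lim_null_comparison[OF _ inv_L_tendsto]) (use bound in auto)
  then show ?thesis using LIMSEQ_unique[OF tendsto_diff[OF b a]] by fastforce
qed

text \<open>Cylinders generate the Borel sets, and they are events about finite windows.\<close>

lemma zero_measure_invariant: "distr zero_measure borel shift = zero_measure"
proof (rule measure_eqI_PiM_infinite)
  interpret prob_space zero_measure by (rule prob_space_zero_measure)
  show 1: "sets zero_measure = sets (PiM UNIV (\<lambda>_. borel))" by (simp add: sets_zero_measure sets_PiM_equal_borel)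
  show 2: "sets (distr zero_measure borel shift) = sets (PiM UNIV (\<lambda>_. borel))" by (simp add: sets_PiM_equal_borel)
  have sh: "shift \<in> measurable zero_measure borel"
    using measurable_shift by (simp add: measurable_cong_sets[OF sets_zero_measure refl])
  show "finite_measure (distr zero_measure borel shift)"
    by (rule finite_measure_distr[OF sh])
  fix A :: "nat \<Rightarrow> nat set" and J :: "nat set"
  assume J: "finite J"
  define C where "C = prod_emb UNIV (\<lambda>_. borel) J (Pi\<^sub>E J A)"
  obtain N where N: "J \<subseteq> {..<N}" using J finite_nat_iff_bounded by blast
  have C: "C = {x. \<forall>i\<in>J. x i \<in> A i}" by (auto simp: C_def prod_emb_def)
  have win: "y \<in> C" if "x \<in> C" "\<And>j. j < N \<Longrightarrow> y j = x j" for x y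
    using that N unfolding C by auto
  have "open C" by (rule open_finite_window) (use win in blast)
  then have Cs: "C \<in> sets borel" by simp
  have "space zero_measure = UNIV" using sets_eq_imp_space_eq[OF sets_zero_measure] by simp
  then have "emeasure (distr zero_measure borel shift) C = emeasure zero_measure (shift -` C)"
    using emeasure_distr[OF sh Cs] by simp
  also have "\<dots> = emeasure zero_measure C"
    using zero_measure_shift_window[of C N] win by (simp add: emeasure_eq_measure)
  finally show "emeasure (distr zero_measure borel shift) (prod_emb UNIV (\<lambda>_. borel) J (Pi\<^sub>E J A)) =
      emeasure zero_measure (prod_emb UNIV (\<lambda>_. borel) J (Pi\<^sub>E J A))"
    by (simp add: C_def)
qed

lemma zero_measure_subshift: "emeasure zero_measure subshift = 1"
proof -
  interpret prob_space digit_seqs by (rule prob_space_digit_seqs)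
  have Xs: "subshift \<in> sets borel" using closed_subshift by simp
  have "AE \<omega> in digit_seqs. limit_seq \<omega> \<in> subshift"
    using AE_digits_not_top
  proof eventually_elim
    case (elim \<omega>)
    show ?case unfolding subshift_iff
    proof
      fix N
      obtain k where "\<forall>j<N. limit_seq \<omega> j = (shift ^^ digit_sum k \<omega>) parity_seq j"
        using eventually_happens'[OF _ limit_seq_window[OF elim, of N]] by auto
      then show "\<exists>a. \<forall>j<N. limit_seq \<omega> j = parity_seq (a + j)"
        by (auto simp: shift_funpow)
    qed
  qed
  then have "emeasure digit_seqs (limit_seq -` subshift \<inter> space digit_seqs) = 1"
    using measurable_sets[OF measurable_limit_seq Xs] by (intro emeasure_eq_1_AE) auto
  then show ?thesis unfolding zero_measure_def by (simp add: emeasure_distr Xs)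
qed

lemma zero_measure_in_shift_measures: "zero_measure \<in> shift_measures subshift"
  by (simp add: shift_measures_iff prob_space_zero_measure sets_zero_measure zero_measure_invariant zero_measure_subshift)

lemma zero_measure_ones: "measure zero_measure {x. x 0 \<noteq> 0} \<le> e"
proof (rule LIMSEQ_le_const2)
  show "(\<lambda>k. real (card {d. d < L k \<and> (shift ^^ d) parity_seq \<in> {x. x 0 \<noteq> 0}}) / real (L k)) \<longlonglongrightarrow>
      measure zero_measure {x. x 0 \<noteq> 0}"
    by (rule zero_measure_window_limit[of _ 1]) auto
  have "real (card {d. d < L k \<and> (shift ^^ d) parity_seq \<in> {x. x 0 \<noteq> 0}}) / real (L k) \<le> e" for k
    using ones_le[of k] by (simp add: shift_funpow parity_seq_def ones_def pos_divide_le_eq)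
  then show "\<exists>N. \<forall>k\<ge>N. real (card {d. d < L k \<and> (shift ^^ d) parity_seq \<in> {x. x 0 \<noteq> 0}}) / real (L k) \<le> e"
    by blast
qed

lemma twist_in_subshift: "x \<in> subshift \<Longrightarrow> y \<in> two_points \<Longrightarrow> twist y x \<in> subshift"
  using subshift_flip by (auto simp: two_points_def twist_def const_seq_def)

text \<open>Take \<open>y\<close> distributed according to \<open>N\<close> and, independently, \<open>x\<close> according to \<open>zero_measure\<close>. The joining is the
  law of the pair of \<open>twist y x\<close> and \<open>y\<close>; as twisting commutes with the shift, it is invariant. Its two
  components differ at 0 exactly if \<open>x\<close> has a nonzero letter there.\<close>

lemma two_points_measure_near_subshift:
  assumes N: "N \<in> shift_measures two_points"
  shows "\<exists>M\<in>shift_measures subshift. dbar_measure M N \<le> ereal e"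
proof -
  interpret N: prob_space N using N by (simp add: shift_measures_iff)
  interpret M: prob_space zero_measure by (rule prob_space_zero_measure)
  interpret pair_prob_space N zero_measure ..
  have sets_N: "sets N = sets borel" and inv: "distr N borel shift = N"
    and N2: "emeasure N two_points = 1"
    using N by (auto simp: shift_measures_iff)
  have sp: "space N = UNIV" "space zero_measure = UNIV"
    using sets_eq_imp_space_eq[OF sets_N] sets_eq_imp_space_eq[OF sets_zero_measure] by simp_all
  have sets_P: "sets (N \<Otimes>\<^sub>M zero_measure) = sets (borel \<Otimes>\<^sub>M borel)"
    by (intro sets_pair_measure_cong sets_N sets_zero_measure)
  have spP: "space (N \<Otimes>\<^sub>M zero_measure) = UNIV" by (simp add: space_pair_measure sp)
  have AE_P: "AE p in N \<Otimes>\<^sub>M zero_measure. p \<in> two_points \<times> subshift"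
  proof -
    have two: "two_points \<in> sets N" "subshift \<in> sets zero_measure"
      using shift_space_two_points closed_subshift by (auto simp: sets_N sets_zero_measure shift_space_def)
    have "emeasure (N \<Otimes>\<^sub>M zero_measure) (two_points \<times> subshift) = 1"
      using M.emeasure_pair_measure_Times[OF two] by (simp add: N2 zero_measure_subshift)
    then show ?thesis by (intro P.AE_prob_1) (simp add: measure_def)
  qed
  define T where "T = (\<lambda>(y, x). (twist y x, y))"
  have T': "T \<in> borel_measurable (borel \<Otimes>\<^sub>M borel)" unfolding T_def by (rule measurable_twist)
  then have T: "T \<in> borel_measurable (N \<Otimes>\<^sub>M zero_measure)"
    unfolding measurable_cong_sets[OF sets_P refl] .
  have fst_b: "fst \<in> borel_measurable (borel :: ((nat \<Rightarrow> nat) \<times> (nat \<Rightarrow> nat)) measure)"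
    and snd_b: "snd \<in> borel_measurable (borel :: ((nat \<Rightarrow> nat) \<times> (nat \<Rightarrow> nat)) measure)"
    by (simp_all add: borel_prod[symmetric])
  define J where "J = distr (N \<Otimes>\<^sub>M zero_measure) borel T"
  define M where "M = distr J borel fst"
  have sh: "shift \<in> measurable N borel" "shift \<in> measurable zero_measure borel"
    using measurable_shift
    by (simp_all add: measurable_cong_sets[OF sets_zero_measure refl] measurable_cong_sets[OF sets_N refl])
  have Jp: "prob_space J" unfolding J_def by (rule prob_space_distr[OF T])
  have JN: "distr J borel snd = N"
  proof -
    have "distr J borel snd = distr (N \<Otimes>\<^sub>M zero_measure) borel (snd \<circ> T)"
      unfolding J_def by (rule distr_distr[OF snd_b T])
    also have "\<dots> = distr (N \<Otimes>\<^sub>M zero_measure) N fst"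
      by (rule distr_cong) (auto simp: sets_N T_def)
    also have "\<dots> = N" by (rule M.distr_pair_fst)
    finally show ?thesis .
  qed
  have PP: "distr (N \<Otimes>\<^sub>M zero_measure) (borel \<Otimes>\<^sub>M borel) (\<lambda>(y, x). (shift y, shift x)) = N \<Otimes>\<^sub>M zero_measure"
    using pair_measure_distr[OF sh] by (simp add: inv zero_measure_invariant M.sigma_finite_measure_axioms)
  have shP: "(\<lambda>(y, x). (shift y, shift x)) \<in> N \<Otimes>\<^sub>M zero_measure \<rightarrow>\<^sub>M borel \<Otimes>\<^sub>M borel"
    using sh by measurable
  have Jinv: "distr J borel (map_prod shift shift) = J"
  proof -
    have "distr J borel (map_prod shift shift) = distr (N \<Otimes>\<^sub>M zero_measure) borel (map_prod shift shift \<circ> T)"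
      unfolding J_def by (rule distr_distr[OF measurable_map_prod_shift T])
    also have "map_prod shift shift \<circ> T = T \<circ> (\<lambda>(y, x). (shift y, shift x))"
      by (auto simp: T_def shift_twist)
    also have "distr (N \<Otimes>\<^sub>M zero_measure) borel \<dots> =
        distr (distr (N \<Otimes>\<^sub>M zero_measure) (borel \<Otimes>\<^sub>M borel) (\<lambda>(y, x). (shift y, shift x))) borel T"
      by (rule distr_distr[symmetric, OF T' shP])
    finally show ?thesis by (simp only: PP J_def)
  qed
  have "J \<in> joinings M N"
    using Jp Jinv JN by (simp add: joinings_def invariant_measures_def M_def J_def)
  then have 1: "dbar_measure M N \<le> ereal (measure J {(x, y). x 0 \<noteq> y 0})"
    unfolding dbar_measure_def by (rule INF_lower)
  have 2: "measure J {(x, y). x 0 \<noteq> y 0} \<le> e"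
  proof -
    have O: "{x :: nat \<Rightarrow> nat. x 0 \<noteq> 0} \<in> sets zero_measure"
    proof -
      have "open {x :: nat \<Rightarrow> nat. x 0 \<noteq> 0}" by (rule open_finite_window[of _ 1]) auto
      then show ?thesis by (simp add: sets_zero_measure)
    qed
    have "measure J {(x, y). x 0 \<noteq> y 0} = measure (N \<Otimes>\<^sub>M zero_measure) (T -` {(x, y). x 0 \<noteq> y 0})"
      unfolding J_def using measure_distr[OF T sets_first_letters_differ] by (simp add: spP)
    also have "\<dots> \<le> measure (N \<Otimes>\<^sub>M zero_measure) (UNIV \<times> {x. x 0 \<noteq> 0})"
    proof (rule P.finite_measure_mono_AE)
      show "AE p in N \<Otimes>\<^sub>M zero_measure. p \<in> T -` {(x, y). x 0 \<noteq> y 0} \<longrightarrow> p \<in> UNIV \<times> {x. x 0 \<noteq> 0}"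
        using AE_P
        by eventually_elim (auto simp: T_def twist_def two_points_def const_seq_def)
      show "UNIV \<times> {x. x 0 \<noteq> 0} \<in> sets (N \<Otimes>\<^sub>M zero_measure)"
        using O sets.top[of N] by (auto simp: sp)
    qed
    also have "\<dots> = measure zero_measure {x. x 0 \<noteq> 0}"
    proof -
      have "emeasure (N \<Otimes>\<^sub>M zero_measure) (UNIV \<times> {x. x 0 \<noteq> 0}) = emeasure N UNIV * emeasure zero_measure {x. x 0 \<noteq> 0}"
        using O sets.top[of N] by (intro M.emeasure_pair_measure_Times) (auto simp: sp)
      then show ?thesis using N.emeasure_space_1 by (simp add: sp measure_def)
    qed
    also have "\<dots> \<le> e" by (rule zero_measure_ones)
    finally show ?thesis .
  qed
  have le: "dbar_measure M N \<le> ereal e"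
    using order_trans[OF 1] 2 by simp
  have "M \<in> shift_measures subshift"
    unfolding shift_measures_iff
  proof (intro conjI)
    interpret J: prob_space J by (rule Jp)
    have fJ: "fst \<in> borel_measurable J" using fst_b by (simp add: J_def)
    show "prob_space M" unfolding M_def by (rule J.prob_space_distr[OF fJ])
    show "sets M = sets borel" by (simp add: M_def)
    have "distr M borel shift = distr J borel (shift \<circ> fst)"
      unfolding M_def by (rule distr_distr[OF measurable_shift fJ])
    also have "shift \<circ> fst = fst \<circ> map_prod shift shift" by auto
    also have "distr J borel \<dots> = distr (distr J borel (map_prod shift shift)) borel fst"
      using measurable_map_prod_shift by (intro distr_distr[symmetric, OF fst_b]) (simp add: J_def)
    finally show "distr M borel shift = M" by (simp only: Jinv M_def)
    have MT: "M = distr (N \<Otimes>\<^sub>M zero_measure) borel (fst \<circ> T)"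
      unfolding M_def J_def by (rule distr_distr[OF fst_b T])
    have fT: "fst \<circ> T \<in> borel_measurable (N \<Otimes>\<^sub>M zero_measure)" using T fst_b by (rule measurable_comp)
    have "AE p in N \<Otimes>\<^sub>M zero_measure. (fst \<circ> T) p \<in> subshift"
      using AE_P by eventually_elim (auto simp: T_def twist_in_subshift)
    then have "emeasure (N \<Otimes>\<^sub>M zero_measure) ((fst \<circ> T) -` subshift \<inter> space (N \<Otimes>\<^sub>M zero_measure)) = 1"
      using measurable_sets[OF fT, of subshift] closed_subshift spP by (intro P.emeasure_eq_1_AE) auto
    then show "emeasure M subshift = 1"
      unfolding MT using closed_subshift by (simp add: emeasure_distr[OF fT])
  qed
  with le show ?thesis by blast
qed

section \<open>A point far from both constant sequences\<close>

text \<open>Where the \<open>i\<close>th factor, a block of level \<open>2 * i\<close>, begins in the oscillating point.\<close>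

fun start :: "nat \<Rightarrow> nat" where
  "start 0 = 0"
| "start (Suc i) = start i + L (2 * i)"

text \<open>The concatenation of the initial blocks of levels 0, 2, 4, ..., every second of them complemented.
  Only even levels are used because passing from a block of level \<open>2 * i + 1\<close> to one of level \<open>2 * i + 2\<close>
  that ends in it switches the type, which makes the types alternate.\<close>

definition wanderer :: "nat \<Rightarrow> nat" where
  "wanderer j = (let i = LEAST i. j < start (Suc i) in of_bool (parity (j - start i) \<noteq> odd i))"

lemma start_strict_mono: "strict_mono start"
  by (simp add: strict_mono_Suc_iff)

lemma wanderer_eq:
  assumes "r < L (2 * i)" shows "wanderer (start i + r) = of_bool (parity r \<noteq> odd i)"
proof -
  have "(LEAST i'. start i + r < start (Suc i')) = i"
  proof (rule Least_equality)
    fix i' assume "start i + r < start (Suc i')"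
    then have "start i < start (Suc i')" by (rule le_less_trans[OF le_add1])
    then have "i < Suc i'" using strict_mono_less[OF start_strict_mono] by blast
    then show "i \<le> i'" by simp
  qed (use assms in simp)
  then show ?thesis by (simp add: wanderer_def)
qed

text \<open>All earlier factors together are negligible compared with the factor that starts here.\<close>

lemma start_le: "real (start i) \<le> e * real (L (2 * i))" and start_le_L: "start i \<le> L (2 * i)"
proof -
  show le: "start i \<le> L (2 * i)" for i
  proof (induction i)
    case (Suc i)
    then show ?case using L_Suc_ge[of "2 * i"] L_Suc_ge[of "Suc (2 * i)"] by simp
  qed simp
  show "real (start i) \<le> e * real (L (2 * i))"
  proof (cases i)
    case 0
    then show ?thesis using e_pos by simp
  next
    case (Suc k)
    have "start i \<le> L (Suc (2 * k))" using le[of k] L_Suc_ge[of "2 * k"] Suc by simp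
    then have "real (start i) \<le> real (L (Suc (2 * k)))" by simp
    also have "\<dots> = 1 / real (m (Suc (2 * k))) * real (L (2 * i))"
      using m_ge[of "Suc (2 * k)"] Suc by (simp add: L_Suc)
    also have "\<dots> \<le> e * real (L (2 * i))"
      by (intro mult_right_mono inverse_m_le) simp
    finally show ?thesis .
  qed
qed

lemma parity_top_block: "i < L k \<Longrightarrow> parity (L (Suc k) - L k + i) = (\<not> parity i)"
  using parity_seq_top_block[of i k] by (cases "parity i"; cases "parity (L (Suc k) - L k + i)") (simp_all add: parity_seq_def)

text \<open>The prefix before each factor is a suffix of a level-\<open>2 * i\<close> block, complemented for even \<open>i\<close>. In the
  induction step, the suffix of a block followed by a block of the opposite type is a suffix of a block of level
  \<open>2 * i + 1\<close>, which in turn is a suffix of the block of level \<open>2 * i + 2\<close> of the opposite type.\<close>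

lemma wanderer_prefix:
  "j < start i \<Longrightarrow> wanderer j = of_bool (parity (L (2 * i) - start i + j) \<noteq> even i)"
proof (induction i arbitrary: j)
  case (Suc i)
  define k where "k = 2 * i"
  \<comment> \<open>The prefix of length \<open>start (Suc i)\<close> is aligned with the end of the last block of level
      \<open>k + 1\<close>; the position \<open>j\<close> has the offset \<open>q\<close> in that block.\<close>
  define q where "q = L (Suc k) - L k - start i + j"
  have le: "start i \<le> L k" "3 * L k \<le> L (Suc k)" "3 * L (Suc k) \<le> L (Suc (Suc k))"
    using start_le_L[of i] L_Suc_ge by (auto simp: k_def)
  have j: "j < start i + L k" using Suc.prems by (simp add: k_def)
  have q: "q < L (Suc k)" using le j by (simp add: q_def)
  have "L (2 * Suc i) - start (Suc i) + j = L (Suc (Suc k)) - L (Suc k) + q"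
    using le by (simp add: q_def k_def)
  then have flip: "parity (L (2 * Suc i) - start (Suc i) + j) = (\<not> parity q)" using parity_top_block[OF q] by simp
  show ?case
  proof (cases "j < start i")
    case True
    define v where "v = L k - start i + j"
    have v: "v < L k" using True le by (simp add: v_def)
    \<comment> \<open>Positions before the last factor fall into the second-to-last block of level \<open>k\<close>,
        which has the type of the surrounding block.\<close>
    have qo: "q = (m k - 2) * L k + v"
    proof -
      have "m k * L k = (m k - 2) * L k + 2 * L k"
      proof -
        have "m k = (m k - 2) + 2" using m_ge[of k] by simp
        then show ?thesis by (metis add_mult_distrib)
      qed
      then show ?thesis using le by (simp add: q_def v_def L_Suc)
    qed
    have "\<not> top_digit k q"
      using qo v m_ge[of k] by (simp add: top_digit_def)
    then have "\<not> high_parity k q" using high_parity_Suc[of k q] high_parity_eq_False[OF q] by simp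
    then have "parity q = parity v" using parity_block[of q k] qo v by simp
    then show ?thesis using flip Suc.IH[OF True] by (simp add: v_def k_def)
  next
    case False
    then obtain r where r: "j = start i + r" "r < L k" using j by (metis add_less_cancel_left le_Suc_ex not_less)
    have "q = L (Suc k) - L k + r" using le r by (simp add: q_def)
    then have "parity q = (\<not> parity r)" using parity_top_block[OF r(2)] by simp
    then show ?thesis using flip wanderer_eq[of r i] r by (simp add: k_def)
  qed
qed simp

text \<open>For odd \<open>i\<close> the prefix is not complemented, so it occurs literally in the generating sequence.\<close>

lemma wanderer_in_subshift: "wanderer \<in> subshift"
  unfolding subshift_iff
proof
  fix N
  define i where "i = Suc (2 * N)"
  have "N \<le> start i" using strict_mono_imp_increasing[OF start_strict_mono, of i] by (simp add: i_def)
  then have "wanderer j = parity_seq (L (2 * i) - start i + j)" if "j < N" for j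
    using wanderer_prefix[of j i] that by (simp add: i_def parity_seq_def del: start.simps)
  then show "\<exists>a. \<forall>j<N. wanderer j = parity_seq (a + j)" by blast
qed

text \<open>Consider the prefixes that end with a factor of the type opposite to \<open>b\<close>. This factor fills all but the
  proportion \<open>e\<close> of the prefix and disagrees with \<open>b\<close> in all but the proportion \<open>e\<close> of its letters.\<close>

lemma wanderer_far: "ereal (1 - 2 * e) \<le> dbar wanderer (const_seq b)"
proof -
  define z where "z = const_seq b"
  define f where "f n = ereal (real (card {j. j < n \<and> wanderer j \<noteq> z j}) / real n)" for n
  \<comment> \<open>The last factor of the prefix of length \<open>r n\<close> has an odd index if and only if \<open>b\<close> is \<open>False\<close>.\<close>
  define r where "r n = start (Suc (2 * n + of_bool (\<not> b)))" for n
  have "strict_mono r"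
    by (intro strict_monoI) (simp add: r_def strict_mono_less[OF start_strict_mono] del: start.simps)
  then have sub: "limsup (f \<circ> r) \<le> limsup f" by (rule limsup_subseq_mono)
  have "ereal (1 - 2 * e) \<le> (f \<circ> r) n" for n
  proof -
    define i where "i = 2 * n + of_bool (\<not> b)"
    have i: "odd i = (\<not> b)" by (simp add: i_def)
    have rn: "r n = start i + L (2 * i)" by (simp add: r_def i_def)
    have "(\<lambda>q. start i + q) ` {q. q < L (2 * i) \<and> \<not> parity q} \<subseteq> {j. j < r n \<and> wanderer j \<noteq> z j}"
      using i by (auto simp: rn z_def const_seq_def wanderer_eq)
    then have "card ((\<lambda>q. start i + q) ` {q. q < L (2 * i) \<and> \<not> parity q}) \<le> card {j. j < r n \<and> wanderer j \<noteq> z j}"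
      by (intro card_mono) auto
    then have "card {q. q < L (2 * i) \<and> \<not> parity q} \<le> card {j. j < r n \<and> wanderer j \<noteq> z j}"
      by (subst (asm) card_image) auto
    moreover have "card {q. q < L (2 * i) \<and> \<not> parity q} = L (2 * i) - ones (2 * i)"
      by (rule card_zeros)
    ultimately have "real (L (2 * i)) - real (ones (2 * i)) \<le> real (card {j. j < r n \<and> wanderer j \<noteq> z j})"
      by linarith
    then have c: "(1 - e) * real (L (2 * i)) \<le> real (card {j. j < r n \<and> wanderer j \<noteq> z j})"
      using ones_le[of "2 * i"] by (simp add: algebra_simps)
    have pos: "0 < real (r n)" using L_pos[of "2 * i"] by (simp add: rn add_nonneg_pos del: L_pos)
    \<comment> \<open>The prefix has length at most \<open>(1 + e) * L (2 * i)\<close>, and \<open>(1 - 2 * e) * (1 + e) \<le> 1 - e\<close>.\<close>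
    have "(1 - 2 * e) * real (r n) \<le> (1 - 2 * e) * ((1 + e) * real (L (2 * i)))"
      using start_le[of i] e_less by (intro mult_left_mono) (auto simp: rn algebra_simps)
    also have "\<dots> = (1 - e - 2 * e\<^sup>2) * real (L (2 * i))" by (simp add: algebra_simps power2_eq_square)
    also have "\<dots> \<le> (1 - e) * real (L (2 * i))" by (intro mult_right_mono) auto
    finally have "(1 - 2 * e) * real (r n) \<le> real (card {j. j < r n \<and> wanderer j \<noteq> z j})"
      using c by linarith
    then show ?thesis using pos by (simp add: f_def pos_le_divide_eq)
  qed
  then have "ereal (1 - 2 * e) \<le> limsup (f \<circ> r)"
    by (intro le_Limsup) auto
  then have "ereal (1 - 2 * e) \<le> limsup f" using sub by (rule order_trans)
  then show ?thesis by (simp add: dbar_def f_def[abs_def] z_def)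
qed

section \<open>The Hausdorff distances\<close>

lemma dbar_measure_nonneg: "0 \<le> dbar_measure M N"
  unfolding dbar_measure_def by (rule INF_greatest) simp

lemma hausdorff_measures:
  "hausdorff_pdist dbar_measure (shift_measures subshift) (shift_measures two_points) \<le> ereal (6 * e)"
  "0 \<le> hausdorff_pdist dbar_measure (shift_measures subshift) (shift_measures two_points)"
proof -
  have "(INF N\<in>shift_measures two_points. dbar_measure M N) \<le> ereal (6 * e)" if "M \<in> shift_measures subshift" for M
    using subshift_measure_near_two_points[OF that] by (meson INF_lower2)
  moreover have "(INF M\<in>shift_measures subshift. dbar_measure M N) \<le> ereal (6 * e)"
    if N: "N \<in> shift_measures two_points" for N
  proof -
    obtain M where "M \<in> shift_measures subshift" "dbar_measure M N \<le> ereal e" using two_points_measure_near_subshift[OF N] by blast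
    moreover have "ereal e \<le> ereal (6 * e)" using e_pos by simp
    ultimately show ?thesis by (meson INF_lower2 order_trans)
  qed
  ultimately show "hausdorff_pdist dbar_measure (shift_measures subshift) (shift_measures two_points) \<le> ereal (6 * e)"
    unfolding hausdorff_pdist_def by (intro max.boundedI SUP_least)
  have "0 \<le> (INF N\<in>shift_measures two_points. dbar_measure zero_measure N)"
    by (rule INF_greatest) (rule dbar_measure_nonneg)
  also have "\<dots> \<le> (SUP M\<in>shift_measures subshift. INF N\<in>shift_measures two_points. dbar_measure M N)"
    by (rule SUP_upper[OF zero_measure_in_shift_measures])
  finally show "0 \<le> hausdorff_pdist dbar_measure (shift_measures subshift) (shift_measures two_points)"
    unfolding hausdorff_pdist_def by (simp add: le_max_iff_disj)
qed

lemma hausdorff_points: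
  "ereal (1 - 2 * e) \<le> hausdorff_pdist dbar subshift two_points"
proof -
  have "ereal (1 - 2 * e) \<le> (INF y\<in>two_points. dbar wanderer y)"
    by (rule INF_greatest) (auto simp: two_points_def intro: wanderer_far)
  also have "\<dots> \<le> (SUP x\<in>subshift. INF y\<in>two_points. dbar x y)" by (rule SUP_upper[OF wanderer_in_subshift])
  finally show ?thesis unfolding hausdorff_pdist_def by (simp add: le_max_iff_disj)
qed

end

lemma dbar_le_1: "dbar x y \<le> 1"
  unfolding dbar_def
proof (rule Limsup_bounded)
  have "real (card {j. j < n \<and> x j \<noteq> y j}) / real n \<le> 1" for n
  proof -
    have "card {j. j < n \<and> x j \<noteq> y j} \<le> card {..<n}" by (rule card_mono) auto
    then show ?thesis by (simp add: divide_le_eq)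
  qed
  then show "\<forall>\<^sub>F n in sequentially. ereal (real (card {j. j < n \<and> x j \<noteq> y j}) / real n) \<le> 1"
    by simp
qed

lemma hausdorff_dbar_le_1:
  assumes "A \<noteq> {}" "B \<noteq> {}" shows "hausdorff_pdist dbar A B \<le> 1"
  unfolding hausdorff_pdist_def
proof (intro max.boundedI SUP_least)
  show "(INF b\<in>B. dbar a b) \<le> 1" for a
    using assms(2) dbar_le_1 by (meson INF_lower2 all_not_in_conv)
  show "(INF a\<in>A. dbar a b) \<le> 1" for b
    using assms(1) dbar_le_1 by (meson INF_lower2 all_not_in_conv)
qed

text \<open>Doubling makes the reciprocals a geometric series; the factor \<open>n + 3\<close> keeps its sum below \<open>1 / 2\<close> and
  makes it tend to 0.\<close>

lemma radix_doubling: "radix (\<lambda>k. (n + 3) * 2 ^ Suc k) (1 / real (n + 3))"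
proof
  show "3 \<le> (n + 3) * 2 ^ Suc k" for k
    using mult_le_mono[of 3 "n + 3" 1 "2 ^ Suc k"] by simp
  show "(\<Sum>i<k. 1 / real ((n + 3) * 2 ^ Suc i)) \<le> 1 / real (n + 3)" for k
  proof -
    have "(\<Sum>i<k. 1 / real ((n + 3) * 2 ^ Suc i)) = 1 / real (n + 3) * (\<Sum>i<k. 1 / 2 ^ Suc i)"
      unfolding sum_distrib_left by (intro sum.cong) simp_all
    also have "\<dots> = 1 / real (n + 3) * (1 - 1 / 2 ^ k)"
    proof -
      have "(\<Sum>i<k. 1 / 2 ^ Suc i :: real) = 1 - 1 / 2 ^ k"
        by (induction k) (simp_all add: field_simps)
      then show ?thesis by simp
    qed
    also have "\<dots> \<le> 1 / real (n + 3)" by (simp add: divide_right_mono)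
    finally show ?thesis .
  qed
  show "1 / real (n + 3) < 1 / 2" by simp
qed

theorem corollary16:
  shows "\<exists>(A :: nat set) (Xs :: nat \<Rightarrow> (nat \<Rightarrow> nat) set) (X :: (nat \<Rightarrow> nat) set).
    finite A \<and>
    (\<forall>n\<ge>1. minimal_shift_space A (Xs n)) \<and>
    shift_space A X \<and>
    (\<lambda>n. hausdorff_pdist dbar_measure (shift_measures (Xs n)) (shift_measures X)) \<longlonglongrightarrow> 0 \<and>
    (\<lambda>n. hausdorff_pdist dbar (Xs n) X) \<longlonglongrightarrow> 1"
proof -
  define e where "e n = 1 / real (n + 3)" for n
  define Xs where "Xs n = radix.subshift (\<lambda>k. (n + 3) * 2 ^ Suc k)" for n
  note radix = radix_doubling[folded e_def]
  have e: "e \<longlonglongrightarrow> 0"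
    unfolding e_def by (rule LIMSEQ_ignore_initial_segment[OF lim_1_over_n])
  have "(\<lambda>n. hausdorff_pdist dbar_measure (shift_measures (Xs n)) (shift_measures two_points)) \<longlonglongrightarrow> 0"
  proof (rule tendsto_sandwich)
    show "(\<lambda>n. 0) \<longlonglongrightarrow> (0 :: ereal)" by simp
    show "(\<lambda>n. ereal (6 * e n)) \<longlonglongrightarrow> 0"
      using tendsto_mult_right_zero[OF e, of 6] by (simp add: zero_ereal_def)
  qed (use radix.hausdorff_measures[OF radix] in \<open>simp_all add: Xs_def\<close>)
  moreover have "(\<lambda>n. hausdorff_pdist dbar (Xs n) two_points) \<longlonglongrightarrow> 1"
  proof (rule tendsto_sandwich)
    have "(\<lambda>n. 1 - 2 * e n) \<longlonglongrightarrow> 1 - 2 * 0" by (intro tendsto_intros e)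
    then show "(\<lambda>n. ereal (1 - 2 * e n)) \<longlonglongrightarrow> 1" by (simp add: one_ereal_def)
    show "(\<lambda>n. 1) \<longlonglongrightarrow> (1 :: ereal)" by simp
    have "hausdorff_pdist dbar (Xs n) two_points \<le> 1" for n
      using radix.shift_space_subshift[OF radix[of n]] shift_space_two_points
      by (intro hausdorff_dbar_le_1) (auto simp: shift_space_def Xs_def)
    then show "\<forall>\<^sub>F n in sequentially. hausdorff_pdist dbar (Xs n) two_points \<le> 1" by simp
  qed (use radix.hausdorff_points[OF radix] in \<open>simp add: Xs_def\<close>)
  ultimately show ?thesis
    using radix.minimal_subshift[OF radix] shift_space_two_points
    by (intro exI[of _ "{0, 1}"] exI[of _ Xs] exI[of _ two_points]) (simp add: Xs_def)
qed

end
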